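(* Let $E=\{0,1,\dots,n\}$, let $M$ be a loopless matroid on $E$, and let $v=(v_1,\dots,v_k)$ be a vector of positive integers. Then in $A^*(M)$, \[\gamma_{v_1}\cdots\gamma_{v_k}=\sum_{(T,\sigma,F)}\mathrm{wt}_v(T,\sigma,F)\,x_{\mathcal{F}(T,F)},\] where the sum is over all $v$-compatible flat-filled increasing binary trees $(T,\sigma,F)$ on $k$ vertices, and $\mathrm{wt}_v$ may be taken to be either $\mathrm{wt}^{\mathrm{OI}}_v$ or $\mathrm{wt}^{\mathrm{mult}}_v$.
   Context: The Chow ring $A^*(M)$ (real coefficients) is $\mathbb{R}[x_G : G \text{ a nonempty proper flat of } M]$ modulo the ideal generated by all $x_{G_1}x_{G_2}$ with $G_1,G_2$ incomparable and all $\sum_{G\ni i}x_G-\sum_{G\ni j}x_G$ for $i,j\in E$. For $S\subseteq E$, $x_S$ means the generator if $S$ is a nonempty proper flat and $0$ otherwise. For a finite set $U$, $S,T\subseteq U$ and an integer $m$: $\mathrm{OI}_U(S,T)=|S\cap T|-\max(0,|S|+|T|-|U|)$ and $\mathrm{mult}_U(|S|,m)=\min(|S|,m)-\frac{m}{|U|}|S|$. Hypersimplex classes: $\gamma_m=\sum_S\mathrm{mult}_E(|S|,m)x_S$ for $1\le m\le n$ (sum over nonempty proper $S\subsetneq E$), $\gamma_m=0$ otherwise. A binary tree is a finite rooted tree in which each vertex has at most one left child and at most one right child; binary trees are considered up to isomorphism. Its binary search order is the total order on vertices generated by $b<a$ whenever $b$ lies in the left subtree of $a$ and $a<b$ whenever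 $b$ lies in the right subtree of $a$. An increasing labeling of a binary tree $T$ with $k$ vertices is a bijection $\sigma:V(T)\to\{1,\dots,k\}$ with $\sigma(b)\ge\sigma(a)$ whenever $b$ is a descendant of $a$; $(T,\sigma)$ is an increasing binary tree. $T_{\le i}$ is the subtree induced on $\sigma^{-1}(\{1,\dots,i\})$ (a binary tree whose binary search order is the restriction). A flat-filling is a map $F$ from $V(T)$ to nonempty proper flats of $M$ such that $a<b$ in binary search order implies $F(a)\subsetneq F(b)$; its image is a chain of flats $\mathcal{F}(T,F)$, and $x_{\mathcal{F}(T,F)}$ is the product of $x_G$ over $G$ in this chain. For $b\in V(T)$, $\ell(b)$ and $r(b)$ are the immediate predecessor and successor of $b$ in the binary search order of $T_{\le\sigma(b)}$, with the conventions $F(\ell(b))=\varnothing$ if $b$ is minimal and $F(r(b))=E$ if $b$ is maximal in $T_{\le\sigma(b)}$. $(T,\sigma,F)$ is $v$-compatible if $|F(\ell(b))|<v_{\sigma(b)}<|F(r(b))|$ for all $b\in V(T)$. The weights are $\mathrm{wt}^{\mathrm{OI}}_v(T,\sigma,F)=\prod_{b}\mathrm{OI}_{F(r(b))\setminus F(\ell(b))}\big(F(b)\setminus F(\ell(b)),U_b\big)$, where $U_b$ is the set of the largest $|F(r(b))|-v_{\sigma(b)}$ elements of $F(r(b))\setminus F(\ell(b))$, and $\mathrm{wt}^{\mathrm{mult}}_v(T,\sigma,F)=\prod_b\mathrm{mult}_{F(r(b))\setminus F(\ell(b))}\big(|F(b)\setminus F(\ell(b))|,\,v_{\sigma(b)}-|F(\ell(b))|\big)$;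 the empty tree has weight $1$. *)

theory Defs
  imports
    Complex_Main
    "HOL-Library.FuncSet"
    "HOL-Library.Sublist"
    "HOL-Library.Poly_Mapping"
    "HOL-Algebra.QuotRing"
begin

section \<open>Matroids\<close>

record 'a set_system =
  ground :: "'a set"
  indep :: "'a set set"

definition matroid :: "'a set_system \<Rightarrow> bool" where
  "matroid M \<longleftrightarrow>
     finite (ground M) \<and>
     indep M \<subseteq> Pow (ground M) \<and>
     {} \<in> indep M \<and>
     (\<forall>I\<in>indep M. \<forall>J. J \<subseteq> I \<longrightarrow> J \<in> indep M) \<and>
     (\<forall>I\<in>indep M. \<forall>J\<in>indep M. card I < card J \<longrightarrow> (\<exists>e\<in>J - I. insert e I \<in> indep M))"

definition loopless :: "'a set_system \<Rightarrow> bool" where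
  "loopless M \<longleftrightarrow> (\<forall>e\<in>ground M. {e} \<in> indep M)"

definition rk :: "'a set_system \<Rightarrow> 'a set \<Rightarrow> nat" where
  "rk M S = Max (card ` {I \<in> indep M. I \<subseteq> S})"

definition flat :: "'a set_system \<Rightarrow> 'a set \<Rightarrow> bool" where
  "flat M G \<longleftrightarrow> G \<subseteq> ground M \<and> (\<forall>e\<in>ground M - G. rk M G < rk M (insert e G))"

definition proper_flats :: "'a set_system \<Rightarrow> 'a set set" where
  "proper_flats M = {G. flat M G \<and> G \<noteq> {} \<and> G \<noteq> ground M}"


section \<open>The Chow ring\<close>

text \<open>
  Monomials are finitely supported exponent vectors, so finitely supported real functions on
  monomials, with their convolution product, are the real polynomials with variables indexed by
  the type \<open>'v\<close>.
\<close>

type_synonym 'v mpoly = "('v \<Rightarrow>\<^sub>0 nat) \<Rightarrow>\<^sub>0 real"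

definition Const :: "real \<Rightarrow> 'v mpoly" where
  "Const c = Poly_Mapping.single 0 c"

definition Var :: "'v \<Rightarrow> 'v mpoly" where
  "Var i = Poly_Mapping.single (Poly_Mapping.single i 1) 1"

definition polynomial_ring :: "'v set \<Rightarrow> 'v mpoly ring" where
  "polynomial_ring I =
     \<lparr>carrier = {p. \<forall>m\<in>Poly_Mapping.keys p. Poly_Mapping.keys m \<subseteq> I},
      mult = (*), one = 1, zero = 0, add = (+)\<rparr>"

definition chow_relations :: "'a set_system \<Rightarrow> 'a set mpoly set" where
  "chow_relations M =
     {Var G\<^sub>1 * Var G\<^sub>2 | G\<^sub>1 G\<^sub>2.
        G\<^sub>1 \<in> proper_flats M \<and> G\<^sub>2 \<in> proper_flats M \<and> \<not> G\<^sub>1 \<subseteq> G\<^sub>2 \<and> \<not> G\<^sub>2 \<subseteq> G\<^sub>1} \<union>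
     {(\<Sum>G\<in>{G \<in> proper_flats M. i \<in> G}. Var G) - (\<Sum>G\<in>{G \<in> proper_flats M. j \<in> G}. Var G) | i j.
        i \<in> ground M \<and> j \<in> ground M}"

definition chow_ideal :: "'a set_system \<Rightarrow> 'a set mpoly set" where
  "chow_ideal M = Idl\<^bsub>polynomial_ring (proper_flats M)\<^esub> (chow_relations M)"

definition chow_ring :: "'a set_system \<Rightarrow> 'a set mpoly set ring" where
  "chow_ring M = polynomial_ring (proper_flats M) Quot chow_ideal M"

definition chow_class :: "'a set_system \<Rightarrow> 'a set mpoly \<Rightarrow> 'a set mpoly set" where
  "chow_class M p = chow_ideal M +>\<^bsub>polynomial_ring (proper_flats M)\<^esub> p"

definition chow_scale :: "'a set_system \<Rightarrow> real \<Rightarrow> 'a set mpoly set \<Rightarrow> 'a set mpoly set" where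
  "chow_scale M c y = chow_class M (Const c) \<otimes>\<^bsub>chow_ring M\<^esub> y"

definition chow_x :: "'a set_system \<Rightarrow> 'a set \<Rightarrow> 'a set mpoly set" where
  "chow_x M S = (if S \<in> proper_flats M then chow_class M (Var S) else \<zero>\<^bsub>chow_ring M\<^esub>)"


section \<open>Hypersimplex classes\<close>

definition OI :: "'a set \<Rightarrow> 'a set \<Rightarrow> 'a set \<Rightarrow> int" where
  "OI U S T = int (card (S \<inter> T)) - max 0 (int (card S) + int (card T) - int (card U))"

definition mlt :: "'a set \<Rightarrow> nat \<Rightarrow> int \<Rightarrow> real" where
  "mlt U s m = real_of_int (min (int s) m) - real_of_int m / real (card U) * real s"

text \<open>The bound below is \<open>1 \<le> m \<le> n\<close>, as the ground set has \<open>n + 1\<close> elements.\<close>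

definition hypersimplex_class :: "'a set_system \<Rightarrow> nat \<Rightarrow> 'a set mpoly set" where
  "hypersimplex_class M m =
     (if 1 \<le> m \<and> m < card (ground M)
      then \<Oplus>\<^bsub>chow_ring M\<^esub>S\<in>{S. S \<noteq> {} \<and> S \<subset> ground M}.
             chow_scale M (mlt (ground M) (card S) (int m)) (chow_x M S)
      else \<zero>\<^bsub>chow_ring M\<^esub>)"


section \<open>Increasing binary trees\<close>

text \<open>
  A vertex is identified with the word of left/right steps leading to it from the root. A binary
  tree becomes its set of vertices, a finite prefix-closed set of words; every isomorphism class of
  binary trees (including the empty one) contains exactly one such set. The descendants of a vertex
  are its extensions.
\<close>

datatype direction = Left | Right

type_synonym vertex = "direction list"

definition binary_tree :: "vertex set \<Rightarrow> bool" where
  "binary_tree T \<longleftrightarrow> finite T \<and> (\<forall>b\<in>T. \<forall>a. prefix a b \<longrightarrow> a \<in> T)"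

definition search_order :: "vertex set \<Rightarrow> (vertex \<times> vertex) set" where
  "search_order T =
     ({(b, a). a \<in> T \<and> b \<in> T \<and> prefix (a @ [Left]) b} \<union>
      {(a, b). a \<in> T \<and> b \<in> T \<and> prefix (a @ [Right]) b})\<^sup>+"

definition increasing_labeling :: "nat \<Rightarrow> vertex set \<Rightarrow> (vertex \<Rightarrow> nat) \<Rightarrow> bool" where
  "increasing_labeling k T \<sigma> \<longleftrightarrow>
     bij_betw \<sigma> T {1..k} \<and> (\<forall>a\<in>T. \<forall>b\<in>T. prefix a b \<longrightarrow> \<sigma> a \<le> \<sigma> b)"

definition subtree_upto :: "vertex set \<Rightarrow> (vertex \<Rightarrow> nat) \<Rightarrow> nat \<Rightarrow> vertex set" where
  "subtree_upto T \<sigma> i = {a \<in> T. \<sigma> a \<le> i}"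

definition flat_filling :: "'a set_system \<Rightarrow> vertex set \<Rightarrow> (vertex \<Rightarrow> 'a set) \<Rightarrow> bool" where
  "flat_filling M T F \<longleftrightarrow>
     F ` T \<subseteq> proper_flats M \<and> (\<forall>a b. (a, b) \<in> search_order T \<longrightarrow> F a \<subset> F b)"

definition covers :: "('v \<times> 'v) set \<Rightarrow> 'v \<Rightarrow> 'v \<Rightarrow> bool" where
  "covers r a b \<longleftrightarrow> (a, b) \<in> r \<and> \<not> (\<exists>c. (a, c) \<in> r \<and> (c, b) \<in> r)"

text \<open>
  The flats attached to the immediate predecessor and the immediate successor of \<open>b\<close>, with the
  conventions for minimal and maximal \<open>b\<close>.
\<close>

definition flat_left :: "vertex set \<Rightarrow> (vertex \<Rightarrow> nat) \<Rightarrow> (vertex \<Rightarrow> 'a set) \<Rightarrow> vertex \<Rightarrow> 'a set" where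
  "flat_left T \<sigma> F b =
     (let r = search_order (subtree_upto T \<sigma> (\<sigma> b)) in
      if \<exists>a. (a, b) \<in> r then F (THE a. covers r a b) else {})"

definition flat_right ::
  "'a set_system \<Rightarrow> vertex set \<Rightarrow> (vertex \<Rightarrow> nat) \<Rightarrow> (vertex \<Rightarrow> 'a set) \<Rightarrow> vertex \<Rightarrow> 'a set" where
  "flat_right M T \<sigma> F b =
     (let r = search_order (subtree_upto T \<sigma> (\<sigma> b)) in
      if \<exists>a. (b, a) \<in> r then F (THE a. covers r b a) else ground M)"

definition compatible ::
  "'a set_system \<Rightarrow> (nat \<Rightarrow> nat) \<Rightarrow> vertex set \<Rightarrow> (vertex \<Rightarrow> nat) \<Rightarrow> (vertex \<Rightarrow> 'a set) \<Rightarrow> bool" where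
  "compatible M v T \<sigma> F \<longleftrightarrow>
     (\<forall>b\<in>T. card (flat_left T \<sigma> F b) < v (\<sigma> b) \<and> v (\<sigma> b) < card (flat_right M T \<sigma> F b))"

text \<open>
  Labelings and fillings are functions on the vertex set only; extensionality makes each of them
  occur once in the index set.
\<close>

definition compatible_trees ::
  "'a set_system \<Rightarrow> nat \<Rightarrow> (nat \<Rightarrow> nat) \<Rightarrow> (vertex set \<times> (vertex \<Rightarrow> nat) \<times> (vertex \<Rightarrow> 'a set)) set" where
  "compatible_trees M k v =
     {(T, \<sigma>, F). binary_tree T \<and>
        \<sigma> \<in> extensional T \<and> increasing_labeling k T \<sigma> \<and>
        F \<in> extensional T \<and> flat_filling M T F \<and> compatible M v T \<sigma> F}"

definition largest :: "nat \<Rightarrow> 'a::linorder set \<Rightarrow> 'a set" where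
  "largest m A = {x \<in> A. card {y \<in> A. x < y} < m}"

definition wt_OI ::
  "'a::linorder set_system \<Rightarrow> (nat \<Rightarrow> nat) \<Rightarrow> vertex set \<Rightarrow> (vertex \<Rightarrow> nat) \<Rightarrow> (vertex \<Rightarrow> 'a set) \<Rightarrow> real" where
  "wt_OI M v T \<sigma> F =
     (\<Prod>b\<in>T.
        let A = flat_left T \<sigma> F b; B = flat_right M T \<sigma> F b
        in real_of_int (OI (B - A) (F b - A) (largest (card B - v (\<sigma> b)) (B - A))))"

definition wt_mult ::
  "'a set_system \<Rightarrow> (nat \<Rightarrow> nat) \<Rightarrow> vertex set \<Rightarrow> (vertex \<Rightarrow> nat) \<Rightarrow> (vertex \<Rightarrow> 'a set) \<Rightarrow> real" where
  "wt_mult M v T \<sigma> F =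
     (\<Prod>b\<in>T.
        let A = flat_left T \<sigma> F b; B = flat_right M T \<sigma> F b
        in mlt (B - A) (card (F b - A)) (int (v (\<sigma> b)) - int (card A)))"

definition chow_x_chain :: "'a set_system \<Rightarrow> vertex set \<Rightarrow> (vertex \<Rightarrow> 'a set) \<Rightarrow> 'a set mpoly set" where
  "chow_x_chain M T F = (\<Otimes>\<^bsub>chow_ring M\<^esub>G\<in>F ` T. chow_x M G)"

end

theory Submission
  imports Defs
begin

text \<open>
  Since all the classes \<open>\<Sum>\<^sub>G\<^sub>\<ni>\<^sub>e x\<^sub>G\<close> agree, \<open>\<gamma>\<^sub>m = \<Sum>\<^sub>S (min |S| m - w(S)) x\<^sub>S\<close> for every weight vector
  \<open>w\<close> on the ground set of total mass \<open>m\<close>. Multiplying by the monomial of a chain of flats kills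
  every \<open>S\<close> that is incomparable to the chain. If \<open>A \<subset> B\<close> is the gap of the chain with
  \<open>|A| < m < |B|\<close>, choosing \<open>w = 1\<close> on \<open>A\<close> and \<open>w = 0\<close> off \<open>B\<close> leaves only the \<open>S\<close> strictly between
  \<open>A\<close> and \<open>B\<close>. Spreading the remaining mass uniformly over \<open>B - A\<close> gives the weight \<open>mult\<close>, and
  placing it on the smallest elements of \<open>B - A\<close> gives \<open>OI\<close>. If some member of the chain has exactly
  \<open>m\<close> elements, its indicator vector shows that the product vanishes. Iterating, \<open>\<gamma>\<^sub>v\<^sub>1 \<cdots> \<gamma>\<^sub>v\<^sub>k\<close>
  becomes a sum over sequences \<open>G\<^sub>1, \<dots>, G\<^sub>k\<close> of pairwise strictly comparable flats. These sequences
  correspond to the flat-filled increasing binary trees by \<open>G\<^sub>i = F (\<sigma>\<^sup>-\<^sup>1 i)\<close>, as the tree is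
  recovered by successive insertion into a binary search tree.
\<close>

section \<open>Binary search order\<close>

text \<open>Placing the vertices at dyadic positions turns the search order into the order of the reals,
  so that it is linear for free.\<close>

fun inorder_pos :: "vertex \<Rightarrow> real" where
  "inorder_pos [] = 0"
| "inorder_pos (Left # w) = (inorder_pos w - 1) / 2"
| "inorder_pos (Right # w) = (inorder_pos w + 1) / 2"

text \<open>The two affine maps send the interval (-1, 1) to (-1, 0) and (0, 1). The strict bounds
  keep a left subtree strictly below its root and a right subtree strictly above it.\<close>

lemma inorder_pos_bounds: "-1 < inorder_pos w \<and> inorder_pos w < 1"
  by (induction w rule: inorder_pos.induct) auto

text \<open>A common prefix applies one and the same composition of strictly increasing affine maps
  to both positions.\<close>

lemma inorder_pos_append_less_iff [simp]:
  "inorder_pos (p @ a) < inorder_pos (p @ b) \<longleftrightarrow> inorder_pos a < inorder_pos b"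
  by (induction p rule: inorder_pos.induct) auto

lemma inorder_pos_Left:
  assumes "prefix (a @ [Left]) b"
  shows "inorder_pos b < inorder_pos a"
proof -
  obtain c where "b = a @ Left # c"
    using assms by (auto simp: prefix_def)
  then show ?thesis
    using inorder_pos_append_less_iff[of a "Left # c" "[]"] inorder_pos_bounds[of c] by simp
qed

lemma inorder_pos_Right:
  assumes "prefix (a @ [Right]) b"
  shows "inorder_pos a < inorder_pos b"
proof -
  obtain c where "b = a @ Right # c"
    using assms by (auto simp: prefix_def)
  then show ?thesis
    using inorder_pos_append_less_iff[of a "[]" "Right # c"] inorder_pos_bounds[of c] by simp
qed

text \<open>Two words agree, or one properly extends the other, or they part after a longest common
  prefix \<open>p\<close>. Every case but equality lets \<open>inorder_pos_Left\<close> and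
  \<open>inorder_pos_Right\<close> decide the comparison of positions.\<close>

lemma vertex_cases:
  obtains "a = b"
  | "prefix (a @ [Left]) b" | "prefix (a @ [Right]) b"
  | "prefix (b @ [Left]) a" | "prefix (b @ [Right]) a"
  | p where "prefix (p @ [Left]) a" "prefix (p @ [Right]) b"
  | p where "prefix (p @ [Right]) a" "prefix (p @ [Left]) b"
proof -
  have ext: "prefix (c @ [Left]) d \<or> prefix (c @ [Right]) d" if cd: "strict_prefix c d" for c d
  proof -
    obtain x y where "d = c @ x # y"
      using cd by (meson strict_prefixE')
    then show ?thesis
      by (cases x) auto
  qed
  show thesis
  proof (cases "a \<parallel> b")
    case True
    then obtain p x y c d where p: "x \<noteq> y" "a = p @ x # c" "b = p @ y # d"
      using parallel_decomp by blast
    then show ?thesis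
      using that(6,7)[of p] by (cases x; cases y) auto
  next
    case False
    then show ?thesis
      using that(1-5) ext by (metis parallelI prefix_order.le_less)
  qed
qed

lemma inj_inorder_pos: "inj inorder_pos"
proof (rule injI)
  fix a b assume eq: "inorder_pos a = inorder_pos b"
  show "a = b"
    by (rule vertex_cases[of a b])
      (use eq in \<open>auto dest!: inorder_pos_Left inorder_pos_Right\<close>)
qed

lemma prefix_snoc_D: "prefix (p @ [x]) a \<Longrightarrow> prefix p a"
  by (auto simp: prefix_def)

text \<open>Both generating relations increase the position, and comparison of positions is
  transitive, so the closure adds nothing more. Conversely, vertices in different branches are
  joined by two generators through the branching vertex, which prefix closure puts in
  \<open>T\<close>.\<close>

lemma search_order_eq:
  assumes "binary_tree T"
  shows "search_order T = {(a, b). a \<in> T \<and> b \<in> T \<and> inorder_pos a < inorder_pos b}"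
proof -
  let ?R = "{(b, a). a \<in> T \<and> b \<in> T \<and> prefix (a @ [Left]) b} \<union>
      {(a, b). a \<in> T \<and> b \<in> T \<and> prefix (a @ [Right]) b}"
  let ?S = "{(a, b). a \<in> T \<and> b \<in> T \<and> inorder_pos a < inorder_pos b}"
  have "?R \<subseteq> ?S"
    using inorder_pos_Left inorder_pos_Right by auto
  moreover have "trans ?S"
    by (auto intro: transI)
  ultimately have "?R\<^sup>+ \<subseteq> ?S"
    using trancl_mono_subset[of ?R ?S] by (simp only: trancl_id)
  moreover have "(a, b) \<in> ?R\<^sup>+" if ab: "(a, b) \<in> ?S" for a b
  proof (rule vertex_cases[of a b])
    fix p assume p: "prefix (p @ [Left]) a" "prefix (p @ [Right]) b"
    then have "p \<in> T"
      using assms ab prefix_snoc_D[OF p(1)] by (auto simp: binary_tree_def)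
    then have "(a, p) \<in> ?R" "(p, b) \<in> ?R"
      using p ab by auto
    then show ?thesis
      by (rule trancl.trancl_into_trancl[OF trancl.r_into_trancl])
  next
    fix p assume "prefix (p @ [Right]) a" "prefix (p @ [Left]) b"
    then show ?thesis
      using ab inorder_pos_Right[of p a] inorder_pos_Left[of p b] by simp
  qed (use ab in \<open>auto dest: inorder_pos_Left inorder_pos_Right intro!: r_into_trancl\<close>)
  ultimately show ?thesis
    unfolding search_order_def by auto
qed

text \<open>Both \<open>b\<close> and \<open>b'\<close> are free places for a new leaf, so neither
  is a proper ancestor of the other. If they were distinct, they would part at a vertex of
  \<open>T\<close> lying between them in position, against \<open>cut\<close>.\<close>

lemma leaf_insertion_unique:
  assumes T: "b \<notin> T" "b' \<notin> T" "\<And>a. strict_prefix a b \<Longrightarrow> a \<in> T" "\<And>a. strict_prefix a b' \<Longrightarrow> a \<in> T"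
    and cut: "\<And>a. a \<in> T \<Longrightarrow> inorder_pos a < inorder_pos b \<longleftrightarrow> inorder_pos a < inorder_pos b'"
  shows "b = b'"
proof (rule ccontr)
  assume "b \<noteq> b'"
  then have np: "\<not> prefix b b'" "\<not> prefix b' b"
    using T by (metis prefix_order.le_less)+
  have *: False if "prefix (p @ [Left]) c" "prefix (p @ [Right]) c'" "{c, c'} = {b, b'}" for p c c'
  proof -
    have "strict_prefix p c"
      using that(1) by (auto simp: prefix_def strict_prefix_def)
    then have "p \<in> T"
      using T that(3) by (auto simp: doubleton_eq_iff)
    then show False
      using cut[of p] inorder_pos_Left[OF that(1)] inorder_pos_Right[OF that(2)] that(3)
      by (auto simp: doubleton_eq_iff)
  qed
  show False
    by (rule vertex_cases[of b b'])
      (use \<open>b \<noteq> b'\<close> np *[of _ b b'] *[of _ b' b] in \<open>auto dest: prefix_snoc_D\<close>)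
qed

text \<open>The new leaf is the point where the descent from the root, going right exactly at the
  vertices of the lower set \<open>L\<close>, leaves the tree.\<close>

lemma leaf_insertion_exists:
  assumes T: "binary_tree T" and L: "\<And>a c. c \<in> L \<Longrightarrow> a \<in> T \<Longrightarrow> inorder_pos a < inorder_pos c \<Longrightarrow> a \<in> L"
  obtains b where "b \<notin> T" "\<And>a. strict_prefix a b \<Longrightarrow> a \<in> T"
    "\<And>a. a \<in> T \<Longrightarrow> inorder_pos a < inorder_pos b \<longleftrightarrow> a \<in> L"
proof -
  define w where "w = rec_nat ([] :: vertex) (\<lambda>_ u. u @ [if u \<in> L then Right else Left])"
  have w0: "w 0 = []" and wS: "w (Suc i) = w i @ [if w i \<in> L then Right else Left]" for i
    by (simp_all add: w_def)
  have len: "length (w i) = i" for i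
    by (induction i) (simp_all add: w0 wS)
  have pre: "take j (w i) = w j" if "j \<le> i" for i j
    using that by (induction i) (auto simp: w0 wS len le_Suc_eq)
  \<comment> \<open>The words \<open>w i\<close> have distinct lengths, so a finite tree cannot
    contain them all.\<close>
  have "\<exists>i. w i \<notin> T"
  proof (rule ccontr)
    assume "\<nexists>i. w i \<notin> T"
    then have "range w \<subseteq> T" by auto
    moreover have "inj w" by (metis injI len)
    ultimately show False
      using T finite_subset finite_imageD infinite_UNIV_nat unfolding binary_tree_def by blast
  qed
  define i where "i = (LEAST i. w i \<notin> T)"
  have iT: "w i \<notin> T" and lt: "\<And>j. j < i \<Longrightarrow> w j \<in> T"
    using \<open>\<exists>i. w i \<notin> T\<close> unfolding i_def by (metis (mono_tags) LeastI_ex, metis not_less_Least)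
  have strict: "\<exists>j<i. a = w j" if "strict_prefix a (w i)" for a
    using that pre len
    by (metis append_eq_conv_conj less_or_eq_imp_le prefix_def prefix_length_less strict_prefix_def)
  \<comment> \<open>Each letter of \<open>w i\<close> records whether the vertex reached before it
    belongs to \<open>L\<close>.\<close>
  have step: "(x = Right) = (a \<in> L)" if "prefix (a @ [x]) (w i)" for a x
  proof -
    have "length a < i"
      using prefix_length_le[OF that] len[of i] by simp
    then have "a @ [x] = w (Suc (length a))"
      using that pre[of "Suc (length a)" i] by (auto simp: prefix_def)
    then have "x = (if a \<in> L then Right else Left)"
      by (auto simp: wS)
    then show ?thesis by simp
  qed
  have "inorder_pos a < inorder_pos (w i) \<longleftrightarrow> a \<in> L" if a: "a \<in> T" for a
  proof (rule vertex_cases[of a "w i"])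
    assume "a = w i" then show ?thesis using a iT by simp
  next
    assume *: "prefix (a @ [Left]) (w i)"
    then show ?thesis using step[OF *] inorder_pos_Left[OF *] by auto
  next
    assume *: "prefix (a @ [Right]) (w i)"
    then show ?thesis using step[OF *] inorder_pos_Right[OF *] by auto
  next
    assume *: "prefix (w i @ [Left]) a"
    then show ?thesis using a iT T prefix_snoc_D[OF *] unfolding binary_tree_def by blast
  next
    assume *: "prefix (w i @ [Right]) a"
    then show ?thesis using a iT T prefix_snoc_D[OF *] unfolding binary_tree_def by blast
  next
    \<comment> \<open>In the two branching cases, \<open>a\<close> leaves the descent path at
      \<open>p\<close> and inherits membership or non-membership in \<open>L\<close> from
      \<open>p\<close>, because \<open>L\<close> is a lower set.\<close>
    fix p assume *: "prefix (p @ [Left]) a" "prefix (p @ [Right]) (w i)"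
    have "p \<in> L" using step[OF *(2)] by simp
    then have "a \<in> L" using L a inorder_pos_Left[OF *(1)] by blast
    then show ?thesis using inorder_pos_Left[OF *(1)] inorder_pos_Right[OF *(2)] by auto
  next
    fix p assume *: "prefix (p @ [Right]) a" "prefix (p @ [Left]) (w i)"
    have "p \<notin> L" using step[OF *(2)] by simp
    moreover have "p \<in> T"
      using T a prefix_snoc_D[OF *(1)] by (auto simp: binary_tree_def)
    ultimately have "a \<notin> L" using L inorder_pos_Right[OF *(1)] by blast
    then show ?thesis using inorder_pos_Right[OF *(1)] inorder_pos_Left[OF *(2)] by auto
  qed
  then show thesis
    using that[of "w i"] iT lt strict by metis
qed

section \<open>Trees and sequences of flats\<close>

text \<open>For a finite chain \<open>C\<close> this is the largest member strictly below
  \<open>S\<close>; the empty union supplies the convention for a minimal vertex.\<close>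

definition lower_flat :: "'a set set \<Rightarrow> 'a set \<Rightarrow> 'a set" where
  "lower_flat C S = \<Union>{H \<in> C. H \<subset> S}"

text \<open>For a finite chain of subsets of \<open>E\<close> this is the smallest member strictly
  above \<open>S\<close>. Meeting with \<open>E\<close> turns the empty intersection, which is
  \<open>UNIV\<close>, into the ground set.\<close>

definition upper_flat :: "'a set \<Rightarrow> 'a set set \<Rightarrow> 'a set \<Rightarrow> 'a set" where
  "upper_flat E C S = E \<inter> \<Inter>{H \<in> C. S \<subset> H}"

text \<open>Only earlier terms enter the bounds at \<open>i\<close>, since the neighbours of a
  vertex are taken in the subtree of labels up to its own.\<close>

definition compatible_seqs :: "'a set_system \<Rightarrow> nat \<Rightarrow> (nat \<Rightarrow> nat) \<Rightarrow> (nat \<Rightarrow> 'a set) set" where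
  "compatible_seqs M k v =
     {G \<in> extensional {1..k}. \<forall>i\<in>{1..k}. G i \<in> proper_flats M \<and>
        (\<forall>j\<in>{1..<i}. G j \<subset> G i \<or> G i \<subset> G j) \<and>
        card (lower_flat (G ` {1..<i}) (G i)) < v i \<and>
        v i < card (upper_flat (ground M) (G ` {1..<i}) (G i))}"

definition tree_seq :: "nat \<Rightarrow> vertex set \<times> (vertex \<Rightarrow> nat) \<times> (vertex \<Rightarrow> 'a set) \<Rightarrow> nat \<Rightarrow> 'a set" where
  "tree_seq k = (\<lambda>(T, \<sigma>, F). restrict (\<lambda>i. F (inv_into T \<sigma> i)) {1..k})"

section \<open>Reading the neighbouring flats of a vertex off the sequence of flats\<close>

locale flat_filled_tree =
  fixes M :: "'a set_system" and k :: nat and T :: "vertex set"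
    and \<sigma> :: "vertex \<Rightarrow> nat" and F :: "vertex \<Rightarrow> 'a set"
  assumes tree: "binary_tree T" and labeling: "increasing_labeling k T \<sigma>"
    and filling: "flat_filling M T F"
begin

abbreviation vert :: "nat \<Rightarrow> vertex" where
  "vert \<equiv> inv_into T \<sigma>"

lemma bij: "bij_betw \<sigma> T {1..k}"
  using labeling by (simp add: increasing_labeling_def)

lemma finite_tree: "finite T"
  using tree by (simp add: binary_tree_def)

lemma vert_label [simp]: "a \<in> T \<Longrightarrow> vert (\<sigma> a) = a"
  using bij by (simp add: bij_betw_def)

lemma label_vert [simp]: "i \<in> {1..k} \<Longrightarrow> \<sigma> (vert i) = i"
  using bij by (metis bij_betw_inv_into_right)

lemma vert_in_tree [simp]: "i \<in> {1..k} \<Longrightarrow> vert i \<in> T"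
  using bij by (metis bij_betw_def inv_into_into)

lemma label_range: "a \<in> T \<Longrightarrow> \<sigma> a \<in> {1..k}"
  using bij by (auto simp: bij_betw_def)

lemma vert_image: "i \<le> Suc k \<Longrightarrow> {a \<in> T. \<sigma> a < i} = vert ` {1..<i}"
proof (intro equalityI subsetI)
  fix a assume "i \<le> Suc k" and a: "a \<in> {a \<in> T. \<sigma> a < i}"
  then have "a = vert (\<sigma> a)" "\<sigma> a \<in> {1..<i}"
    using label_range[of a] by auto
  then show "a \<in> vert ` {1..<i}" by blast
next
  fix a assume i: "i \<le> Suc k" and "a \<in> vert ` {1..<i}"
  then obtain j where j: "a = vert j" "j \<in> {1..<i}" by blast
  then have "j \<in> {1..k}" using i by auto
  then show "a \<in> {a \<in> T. \<sigma> a < i}" using j by simp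
qed

text \<open>\<open>F\<close> is strictly increasing and the search order is linear, so inclusion of
  flats also reflects the order.\<close>

lemma filling_less_iff:
  assumes "a \<in> T" "b \<in> T"
  shows "F a \<subset> F b \<longleftrightarrow> inorder_pos a < inorder_pos b"
proof -
  have *: "F c \<subset> F d" if "c \<in> T" "d \<in> T" "inorder_pos c < inorder_pos d" for c d
    using filling that by (auto simp: flat_filling_def search_order_eq[OF tree])
  show ?thesis
    using *[of a b] *[of b a] assms inj_inorder_pos[THEN injD, of a b] by fastforce
qed

text \<open>Labels increase from ancestors to descendants, so the vertices with label at most
  \<open>i\<close> are prefix-closed and \<open>search_order_eq\<close> applies to them.\<close>

lemma search_order_upto:
  "search_order (subtree_upto T \<sigma> i) =
     {(a, b). a \<in> T \<and> \<sigma> a \<le> i \<and> b \<in> T \<and> \<sigma> b \<le> i \<and> inorder_pos a < inorder_pos b}"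
proof -
  have "binary_tree (subtree_upto T \<sigma> i)"
    unfolding binary_tree_def
  proof (intro conjI ballI allI impI)
    fix b a assume "b \<in> subtree_upto T \<sigma> i" "prefix a b"
    moreover from this have "a \<in> T"
      using tree by (auto simp: binary_tree_def subtree_upto_def)
    ultimately show "a \<in> subtree_upto T \<sigma> i"
      using labeling by (fastforce simp: increasing_labeling_def subtree_upto_def)
  qed (use finite_tree in \<open>simp add: subtree_upto_def\<close>)
  then show ?thesis
    by (auto simp: search_order_eq subtree_upto_def)
qed

lemma label_less_iff:
  assumes "b \<in> T" "a \<in> T" "a \<noteq> b"
  shows "\<sigma> a \<le> \<sigma> b \<longleftrightarrow> \<sigma> a < \<sigma> b"
  using assms by (metis le_less vert_label)

text \<open>The predecessor of \<open>b\<close> is the vertex \<open>m\<close> of greatest position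
  among the earlier vertices to the left of \<open>b\<close>. Since \<open>F\<close> is monotone,
  \<open>F m\<close> is the union of their flats; without such vertices both sides are
  empty.\<close>

lemma flat_left_eq:
  assumes b: "b \<in> T"
  shows "flat_left T \<sigma> F b = lower_flat (F ` {a \<in> T. \<sigma> a < \<sigma> b}) (F b)"
proof -
  define r where "r = search_order (subtree_upto T \<sigma> (\<sigma> b))"
  define D where "D = {a \<in> T. \<sigma> a \<le> \<sigma> b \<and> inorder_pos a < inorder_pos b}"
  have r: "(a, c) \<in> r \<longleftrightarrow> a \<in> T \<and> \<sigma> a \<le> \<sigma> b \<and> c \<in> T \<and> \<sigma> c \<le> \<sigma> b \<and> inorder_pos a < inorder_pos c"
    for a c
    by (auto simp: r_def search_order_upto)
  have D: "D = {a \<in> T. \<sigma> a < \<sigma> b \<and> F a \<subset> F b}"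
    using b filling_less_iff label_less_iff unfolding D_def by (metis order_less_irrefl)
  have rhs: "lower_flat (F ` {a \<in> T. \<sigma> a < \<sigma> b}) (F b) = \<Union>(F ` D)"
    by (auto simp: lower_flat_def D)
  show ?thesis
  proof (cases "D = {}")
    case True
    then have "\<nexists>a. (a, b) \<in> r"
      using r b by (auto simp: D_def)
    then show ?thesis
      using True rhs by (simp add: flat_left_def Let_def flip: r_def)
  next
    case False
    have "finite D"
      using finite_tree by (simp add: D_def)
    then have "Max (inorder_pos ` D) \<in> inorder_pos ` D"
      using False by simp
    then obtain m where m: "Max (inorder_pos ` D) = inorder_pos m" "m \<in> D"
      by (rule imageE)
    have m: "m \<in> D" "\<And>a. a \<in> D \<Longrightarrow> inorder_pos a \<le> inorder_pos m"
      using \<open>finite D\<close> m(2) by (simp_all flip: m(1))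
    have "a = m" if "covers r a b" for a
    proof (rule ccontr)
      assume "a \<noteq> m"
      have "a \<in> D"
        using that b by (auto simp: covers_def r D_def)
      then have "inorder_pos a < inorder_pos m"
        using m(2)[of a] \<open>a \<noteq> m\<close> inj_inorder_pos by (metis injD order_le_less)
      then have "(a, m) \<in> r" "(m, b) \<in> r"
        using m(1) \<open>a \<in> D\<close> b by (auto simp: r D_def)
      then show False
        using that by (auto simp: covers_def)
    qed
    moreover have "covers r m b"
      using m b by (fastforce simp: covers_def r D_def)
    ultimately have "(THE a. covers r a b) = m"
      by blast
    moreover have "\<exists>a. (a, b) \<in> r"
      using m(1) b by (auto simp: r D_def)
    moreover have "F a \<subseteq> F m" if "a \<in> D" for a
      using m that filling_less_iff[of a m] inj_inorder_pos[THEN injD, of a m] unfolding D_def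
      by (metis (mono_tags, lifting) mem_Collect_eq order_le_less)
    ultimately show ?thesis
      using rhs m(1) by (auto simp: flat_left_def Let_def simp flip: r_def)
  qed
qed

text \<open>Dual to \<open>flat_left_eq\<close>, with the vertex \<open>m\<close> of least position
  to the right of \<open>b\<close>. As \<open>F m\<close> lies in the ground set, meeting with
  \<open>ground M\<close> does not shrink it; without such vertices both sides are
  \<open>ground M\<close>.\<close>

lemma flat_right_eq:
  assumes b: "b \<in> T"
  shows "flat_right M T \<sigma> F b = upper_flat (ground M) (F ` {a \<in> T. \<sigma> a < \<sigma> b}) (F b)"
proof -
  define r where "r = search_order (subtree_upto T \<sigma> (\<sigma> b))"
  define D where "D = {a \<in> T. \<sigma> a \<le> \<sigma> b \<and> inorder_pos b < inorder_pos a}"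
  have r: "(a, c) \<in> r \<longleftrightarrow> a \<in> T \<and> \<sigma> a \<le> \<sigma> b \<and> c \<in> T \<and> \<sigma> c \<le> \<sigma> b \<and> inorder_pos a < inorder_pos c"
    for a c
    by (auto simp: r_def search_order_upto)
  have D: "D = {a \<in> T. \<sigma> a < \<sigma> b \<and> F b \<subset> F a}"
    using b filling_less_iff label_less_iff unfolding D_def by (metis order_less_irrefl)
  have rhs: "upper_flat (ground M) (F ` {a \<in> T. \<sigma> a < \<sigma> b}) (F b) = ground M \<inter> \<Inter>(F ` D)"
    by (auto simp: upper_flat_def D)
  show ?thesis
  proof (cases "D = {}")
    case True
    then have "\<nexists>a. (b, a) \<in> r"
      using r b by (auto simp: D_def)
    then show ?thesis
      using True rhs by (simp add: flat_right_def Let_def flip: r_def)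
  next
    case False
    have "finite D"
      using finite_tree by (simp add: D_def)
    then have "Min (inorder_pos ` D) \<in> inorder_pos ` D"
      using False by simp
    then obtain m where m: "Min (inorder_pos ` D) = inorder_pos m" "m \<in> D"
      by (rule imageE)
    have m: "m \<in> D" "\<And>a. a \<in> D \<Longrightarrow> inorder_pos m \<le> inorder_pos a"
      using \<open>finite D\<close> m(2) by (simp_all flip: m(1))
    have "a = m" if "covers r b a" for a
    proof (rule ccontr)
      assume "a \<noteq> m"
      have "a \<in> D"
        using that b by (auto simp: covers_def r D_def)
      then have "inorder_pos m < inorder_pos a"
        using m(2)[of a] \<open>a \<noteq> m\<close> inj_inorder_pos by (metis injD order_le_less)
      then have "(m, a) \<in> r" "(b, m) \<in> r"
        using m(1) \<open>a \<in> D\<close> b by (auto simp: r D_def)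
      then show False
        using that by (auto simp: covers_def)
    qed
    moreover have "covers r b m"
      using m b by (fastforce simp: covers_def r D_def)
    ultimately have "(THE a. covers r b a) = m"
      by blast
    moreover have "\<exists>a. (b, a) \<in> r"
      using m(1) b by (auto simp: r D_def)
    moreover have "F m \<subseteq> F a" if "a \<in> D" for a
      using m that filling_less_iff[of m a] inj_inorder_pos[THEN injD, of m a] unfolding D_def
      by (metis (mono_tags, lifting) mem_Collect_eq order_le_less)
    moreover have "F m \<subseteq> ground M"
      using filling m(1) by (auto simp: flat_filling_def D_def proper_flats_def flat_def)
    ultimately show ?thesis
      using rhs m(1) by (auto simp: flat_right_def Let_def simp flip: r_def)
  qed
qed

abbreviation seq :: "nat \<Rightarrow> 'a set" where
  "seq \<equiv> tree_seq k (T, \<sigma>, F)"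

lemma seq_vert: "i \<in> {1..k} \<Longrightarrow> seq i = F (vert i)"
  by (simp add: tree_seq_def)

lemma seq_label: "b \<in> T \<Longrightarrow> seq (\<sigma> b) = F b"
  using label_range by (simp add: tree_seq_def)

lemma seq_image: "i \<le> Suc k \<Longrightarrow> seq ` {1..<i} = F ` {a \<in> T. \<sigma> a < i}"
  by (simp add: vert_image image_image tree_seq_def)

lemma seq_image_all: "seq ` {1..k} = F ` T"
proof -
  have "{a \<in> T. \<sigma> a < Suc k} = T"
    using label_range by fastforce
  then show ?thesis
    using seq_image[of "Suc k"] by (simp add: atLeastLessThanSuc_atLeastAtMost)
qed

lemma flat_left_seq: "b \<in> T \<Longrightarrow> flat_left T \<sigma> F b = lower_flat (seq ` {1..<\<sigma> b}) (seq (\<sigma> b))"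
  using flat_left_eq label_range[of b] seq_image[of "\<sigma> b"] seq_label by simp

lemma flat_right_seq:
  "b \<in> T \<Longrightarrow> flat_right M T \<sigma> F b = upper_flat (ground M) (seq ` {1..<\<sigma> b}) (seq (\<sigma> b))"
  using flat_right_eq label_range[of b] seq_image[of "\<sigma> b"] seq_label by simp

lemma seq_less_iff:
  "i \<in> {1..k} \<Longrightarrow> j \<in> {1..k} \<Longrightarrow> seq i \<subset> seq j \<longleftrightarrow> inorder_pos (vert i) < inorder_pos (vert j)"
  by (simp add: seq_vert filling_less_iff)

lemma compatible_iff:
  "compatible M v T \<sigma> F \<longleftrightarrow>
     (\<forall>i\<in>{1..k}. card (lower_flat (seq ` {1..<i}) (seq i)) < v i \<and>
        v i < card (upper_flat (ground M) (seq ` {1..<i}) (seq i)))"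
proof -
  have "(\<forall>b\<in>T. P (\<sigma> b)) \<longleftrightarrow> (\<forall>i\<in>{1..k}. P i)" for P
    using bij by (metis bij_betw_apply label_vert vert_in_tree)
  from this[of "\<lambda>i. card (lower_flat (seq ` {1..<i}) (seq i)) < v i \<and>
        v i < card (upper_flat (ground M) (seq ` {1..<i}) (seq i))"]
  show ?thesis
    unfolding compatible_def by (simp add: flat_left_seq flat_right_seq)
qed

text \<open>The function \<open>f\<close> stands for one factor of either weight; reindexing along
  \<open>\<sigma>\<close> turns both weights into products over the positions of the
  sequence.\<close>

lemma prod_tree:
  "(\<Prod>b\<in>T. f (flat_left T \<sigma> F b) (flat_right M T \<sigma> F b) (F b) (v (\<sigma> b))) =
     (\<Prod>i\<in>{1..k}. f (lower_flat (seq ` {1..<i}) (seq i)) (upper_flat (ground M) (seq ` {1..<i}) (seq i))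
        (seq i) (v i))"
  by (subst prod.reindex_bij_betw[OF bij, symmetric])
    (simp add: flat_left_seq flat_right_seq seq_label)

lemma seq_compatible:
  assumes "compatible M v T \<sigma> F"
  shows "seq \<in> compatible_seqs M k v"
proof -
  have "seq i \<in> proper_flats M \<and> (\<forall>j\<in>{1..<i}. seq j \<subset> seq i \<or> seq i \<subset> seq j)"
    if i: "i \<in> {1..k}" for i
  proof (intro conjI ballI)
    show "seq i \<in> proper_flats M"
      using filling i by (auto simp: flat_filling_def seq_vert)
    fix j assume "j \<in> {1..<i}"
    then have j: "j \<in> {1..k}" "j \<noteq> i" using i by auto
    then have "vert j \<noteq> vert i" using i by (metis label_vert)
    then have "inorder_pos (vert j) \<noteq> inorder_pos (vert i)"
      using inj_inorder_pos by (metis injD)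
    then show "seq j \<subset> seq i \<or> seq i \<subset> seq j"
      using i j by (simp add: seq_less_iff) linarith
  qed
  moreover have "seq \<in> extensional {1..k}"
    by (simp add: tree_seq_def)
  ultimately show ?thesis
    using assms unfolding compatible_iff compatible_seqs_def by blast
qed

text \<open>Ancestors carry smaller labels, so \<open>vert i\<close> is attached as a leaf to the
  tree of the earlier vertices, as \<open>leaf_insertion_unique\<close> requires.\<close>

lemma strict_prefix_vert:
  assumes "i \<in> {1..k}" "strict_prefix a (vert i)"
  shows "a \<in> vert ` {1..<i}"
proof -
  have a: "a \<in> T" "\<sigma> a \<le> \<sigma> (vert i)" "a \<noteq> vert i"
    using assms tree labeling
    unfolding binary_tree_def increasing_labeling_def strict_prefix_def
    by (metis vert_in_tree)+
  then have "a \<in> {a \<in> T. \<sigma> a < i}"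
    using label_less_iff[of "vert i" a] assms by simp
  then show ?thesis
    using vert_image[of i] assms by (metis atLeastAtMost_iff le_SucI)
qed

lemma vert_fresh: "i \<in> {1..k} \<Longrightarrow> vert i \<notin> vert ` {1..<i}"
  using vert_image[of i] label_vert[of i] by (metis (lifting) atLeastAtMost_iff le_SucI less_irrefl mem_Collect_eq)

end

section \<open>The bijection between trees and sequences of flats\<close>

lemma compatible_trees_iff:
  "(T, \<sigma>, F) \<in> compatible_trees M k v \<longleftrightarrow>
     flat_filled_tree M k T \<sigma> F \<and> \<sigma> \<in> extensional T \<and> F \<in> extensional T \<and> compatible M v T \<sigma> F"
  by (auto simp: compatible_trees_def flat_filled_tree_def)

text \<open>By induction on the label the earlier vertices agree. The flats tell on which side of
  each of them the next vertex lies, and \<open>leaf_insertion_unique\<close> fixes its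
  place.\<close>

lemma inj_on_tree_seq:
  fixes M :: "'a set_system"
  shows "inj_on (tree_seq k) (compatible_trees M k v)"
proof (rule inj_onI)
  fix t t' :: "vertex set \<times> (vertex \<Rightarrow> nat) \<times> (vertex \<Rightarrow> 'a set)"
  assume t: "t \<in> compatible_trees M k v" and t': "t' \<in> compatible_trees M k v"
    and eq: "tree_seq k t = tree_seq k t'"
  obtain T \<sigma> F T' \<sigma>' F' where tt: "t = (T, \<sigma>, F)" "t' = (T', \<sigma>', F')"
    by (metis prod.exhaust)
  note t = t[unfolded tt] and t' = t'[unfolded tt] and eq = eq[unfolded tt]
  interpret A: flat_filled_tree M k T \<sigma> F
    using t by (simp add: compatible_trees_iff)
  interpret B: flat_filled_tree M k T' \<sigma>' F'
    using t' by (simp add: compatible_trees_iff)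
  have vert: "i \<in> {1..k} \<Longrightarrow> A.vert i = B.vert i" for i
  proof (induction i rule: less_induct)
    case (less i)
    then have IH: "A.vert j = B.vert j" if "j \<in> {1..<i}" for j
      using that by auto
    then have im: "A.vert ` {1..<i} = B.vert ` {1..<i}"
      by simp
    show ?case
    proof (rule leaf_insertion_unique[where T = "A.vert ` {1..<i}"])
      fix a assume "a \<in> A.vert ` {1..<i}"
      then obtain j where j: "j \<in> {1..<i}" "a = A.vert j" "a = B.vert j"
        using IH by blast
      then have "j \<in> {1..k}" using less.prems by auto
      then show "inorder_pos a < inorder_pos (A.vert i) \<longleftrightarrow> inorder_pos a < inorder_pos (B.vert i)"
        using j less.prems A.seq_less_iff[of j i] B.seq_less_iff[of j i] eq by simp
    qed (use less.prems A.vert_fresh[of i] B.vert_fresh[of i] A.strict_prefix_vert[of i]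
          B.strict_prefix_vert[of i] im in \<open>simp_all only: simp_thms\<close>)
  qed
  have T: "T = A.vert ` {1..k}" "T' = B.vert ` {1..k}"
    using A.bij B.bij by (metis bij_betw_imp_surj_on bij_betw_inv_into)+
  then have TT: "T = T'"
    using vert by simp
  have "\<sigma> a = \<sigma>' a" if "a \<in> T" for a
    using that T vert TT by (metis (no_types, lifting) A.label_vert B.label_vert imageE)
  moreover have "F a = F' a" if "a \<in> T" for a
    using that TT calculation A.seq_label B.seq_label eq by metis
  ultimately show "t = t'"
    unfolding tt using t t' TT by (auto simp: compatible_trees_iff intro: extensionalityI)
qed

lemma inj_on_if_fresh:
  fixes f :: "nat \<Rightarrow> 'b"
  assumes "\<And>i. i \<in> {1..k} \<Longrightarrow> f i \<notin> f ` {1..<i}"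
  shows "inj_on f {1..k}"
proof (rule linorder_inj_onI)
  fix i j assume "i < j" "i \<in> {1..k}" "j \<in> {1..k}"
  then have "f i \<in> f ` {1..<j}" by auto
  then show "f i \<noteq> f j"
    using assms[OF \<open>j \<in> {1..k}\<close>] by metis
qed auto

text \<open>This is insertion into a binary search tree, one flat at a time: the vertices whose
  flats lie below the new flat form a lower set, and \<open>leaf_insertion_exists\<close> places the
  new leaf at that cut.\<close>

lemma exists_vertex_seq:
  fixes G :: "nat \<Rightarrow> 'a set"
  assumes "\<And>i j. i \<in> {1..k} \<Longrightarrow> j \<in> {1..<i} \<Longrightarrow> G j \<subset> G i \<or> G i \<subset> G j"
  shows "\<exists>\<tau>. \<forall>i\<in>{1..k}. \<tau> i \<notin> \<tau> ` {1..<i} \<and> (\<forall>a. strict_prefix a (\<tau> i) \<longrightarrow> a \<in> \<tau> ` {1..<i}) \<and>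
          (\<forall>j\<in>{1..<i}. inorder_pos (\<tau> j) < inorder_pos (\<tau> i) \<longleftrightarrow> G j \<subset> G i)"
  using assms
proof (induction k)
  case 0
  then show ?case by simp
next
  case (Suc k)
  then obtain \<tau> where \<tau>: "\<And>i. i \<in> {1..k} \<Longrightarrow> \<tau> i \<notin> \<tau> ` {1..<i}"
    "\<And>i a. i \<in> {1..k} \<Longrightarrow> strict_prefix a (\<tau> i) \<Longrightarrow> a \<in> \<tau> ` {1..<i}"
    "\<And>i j. i \<in> {1..k} \<Longrightarrow> j \<in> {1..<i} \<Longrightarrow> inorder_pos (\<tau> j) < inorder_pos (\<tau> i) \<longleftrightarrow> G j \<subset> G i"
    by (metis atLeastAtMost_iff le_Suc_eq)
  define T where "T = \<tau> ` {1..k}"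
  define L where "L = \<tau> ` {j \<in> {1..k}. G j \<subset> G (Suc k)}"
  have inj: "inj_on \<tau> {1..k}"
    using \<tau>(1) by (rule inj_on_if_fresh)
  have "binary_tree T"
    unfolding binary_tree_def
  proof (intro conjI ballI allI impI)
    fix b a assume "b \<in> T" "prefix a b"
    then show "a \<in> T"
      using \<tau>(2) by (cases "a = b") (fastforce simp: T_def strict_prefix_def)+
  qed (simp add: T_def)
  moreover have "a \<in> L" if c: "c \<in> L" and a: "a \<in> T" and lt: "inorder_pos a < inorder_pos c" for a c
  proof -
    obtain j where j: "c = \<tau> j" "j \<in> {1..k}" "G j \<subset> G (Suc k)"
      using c by (auto simp: L_def)
    obtain l where l: "a = \<tau> l" "l \<in> {1..k}"
      using a by (auto simp: T_def)
    \<comment> \<open>The property at the larger of the two indices decides. If that is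
      \<open>l\<close>, it only rules out \<open>G j \<subset> G l\<close>, and comparability of the
      flats gives the claim.\<close>
    have "G l \<subset> G j"
      using \<tau>(3)[of j l] \<tau>(3)[of l j] Suc.prems[of l j] j l lt by (cases l j rule: linorder_cases) auto
    then show ?thesis
      using j l by (auto simp: L_def)
  qed
  ultimately obtain b where b: "b \<notin> T" "\<And>a. strict_prefix a b \<Longrightarrow> a \<in> T"
    "\<And>a. a \<in> T \<Longrightarrow> inorder_pos a < inorder_pos b \<longleftrightarrow> a \<in> L"
    using leaf_insertion_exists by metis
  have L: "\<tau> j \<in> L \<longleftrightarrow> G j \<subset> G (Suc k)" if "j \<in> {1..k}" for j
    unfolding L_def using that by (subst inj_on_image_mem_iff[OF inj]) auto
  let ?\<tau> = "\<tau>(Suc k := b)"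
  have im: "?\<tau> ` {1..<i} = \<tau> ` {1..<i}" if "i \<le> Suc k" for i
    using that by auto
  show ?case
  proof (rule exI[of _ ?\<tau>], rule ballI)
    fix i assume i: "i \<in> {1..Suc k}"
    show "?\<tau> i \<notin> ?\<tau> ` {1..<i} \<and> (\<forall>a. strict_prefix a (?\<tau> i) \<longrightarrow> a \<in> ?\<tau> ` {1..<i}) \<and>
          (\<forall>j\<in>{1..<i}. inorder_pos (?\<tau> j) < inorder_pos (?\<tau> i) \<longleftrightarrow> G j \<subset> G i)"
    proof (cases "i = Suc k")
      case True
      then have "?\<tau> ` {1..<i} = T"
        using im[of i] by (simp add: T_def atLeastLessThanSuc_atLeastAtMost)
      then show ?thesis
        using True b L by (auto simp: T_def)
    next
      case False
      then have "i \<in> {1..k}" using i by auto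
      then show ?thesis
        using im[of i] \<tau>[of i] False by auto
    qed
  qed
qed

text \<open>The vertex inserted at step \<open>i\<close> gets label \<open>i\<close> and flat
  \<open>G i\<close>. Its proper ancestors were inserted before it, which makes the labeling
  increasing.\<close>

lemma tree_seq_surj:
  fixes G :: "nat \<Rightarrow> 'a set"
  assumes G: "G \<in> compatible_seqs M k v"
  shows "G \<in> tree_seq k ` compatible_trees M k v"
proof -
  have cmp: "G j \<subset> G i \<or> G i \<subset> G j" if "i \<in> {1..k}" "j \<in> {1..<i}" for i j
    using G that by (simp add: compatible_seqs_def)
  obtain \<tau> where \<tau>: "\<And>i. i \<in> {1..k} \<Longrightarrow> \<tau> i \<notin> \<tau> ` {1..<i}"
    "\<And>i a. i \<in> {1..k} \<Longrightarrow> strict_prefix a (\<tau> i) \<Longrightarrow> a \<in> \<tau> ` {1..<i}"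
    "\<And>i j. i \<in> {1..k} \<Longrightarrow> j \<in> {1..<i} \<Longrightarrow> inorder_pos (\<tau> j) < inorder_pos (\<tau> i) \<longleftrightarrow> G j \<subset> G i"
    using exists_vertex_seq[of k G] cmp by metis
  have inj: "inj_on \<tau> {1..k}"
    using \<tau>(1) by (rule inj_on_if_fresh)
  define T where "T = \<tau> ` {1..k}"
  define \<sigma> where "\<sigma> = restrict (inv_into {1..k} \<tau>) T"
  define F where "F = restrict (\<lambda>a. G (\<sigma> a)) T"
  have \<sigma>\<tau>: "\<sigma> (\<tau> i) = i" "F (\<tau> i) = G i" "\<tau> i \<in> T" if "i \<in> {1..k}" for i
    using that inj by (simp_all add: \<sigma>_def T_def F_def)
  have bij: "bij_betw \<sigma> T {1..k}"
    by (rule bij_betw_byWitness[where f' = \<tau>]) (use \<sigma>\<tau> in \<open>auto simp: T_def\<close>)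
  have pre: "i < j" if ij: "i \<in> {1..k}" "j \<in> {1..k}" "strict_prefix (\<tau> i) (\<tau> j)" for i j
  proof -
    obtain l where l: "l \<in> {1..<j}" "\<tau> i = \<tau> l"
      using \<tau>(2)[OF ij(2,3)] by blast
    then have "i = l"
      using ij inj by (auto dest: inj_onD)
    then show ?thesis using l by simp
  qed
  interpret flat_filled_tree M k T \<sigma> F
  proof
    show bt: "binary_tree T"
      unfolding binary_tree_def
    proof (intro conjI ballI allI impI)
      fix b a assume "b \<in> T" "prefix a b"
      then show "a \<in> T"
        using \<tau>(2) by (cases "a = b") (fastforce simp: T_def strict_prefix_def)+
    qed (simp add: T_def)
    show "increasing_labeling k T \<sigma>"
      unfolding increasing_labeling_def
    proof (intro conjI ballI impI bij)
      fix a b assume "a \<in> T" "b \<in> T" and ab: "prefix a b"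
      then obtain i j where ij: "a = \<tau> i" "i \<in> {1..k}" "b = \<tau> j" "j \<in> {1..k}"
        unfolding T_def by blast
      then have "a = b \<or> i < j"
        using pre[of i j] ab by (metis prefix_order.le_less)
      then show "\<sigma> a \<le> \<sigma> b"
        using ij \<sigma>\<tau>(1)[of i] \<sigma>\<tau>(1)[of j] by (metis less_imp_le order_refl)
    qed
    have "F a \<subset> F b" if ab: "a \<in> T" "b \<in> T" "inorder_pos a < inorder_pos b" for a b
    proof -
      obtain i j where "a = \<tau> i" "i \<in> {1..k}" "b = \<tau> j" "j \<in> {1..k}"
        using ab(1,2) unfolding T_def by blast
      then show ?thesis
        using \<sigma>\<tau>(2)[of i] \<sigma>\<tau>(2)[of j] \<tau>(3)[of j i] \<tau>(3)[of i j] cmp[of i j] ab(3)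
        by (cases i j rule: linorder_cases) auto
    qed
    moreover have "F ` T \<subseteq> proper_flats M"
      using G \<sigma>\<tau> by (auto simp: T_def compatible_seqs_def)
    ultimately show "flat_filling M T F"
      by (auto simp: flat_filling_def search_order_eq[OF bt])
  qed
  have "seq i = G i" for i
  proof (cases "i \<in> {1..k}")
    case True
    then show ?thesis
      using \<sigma>\<tau>[of i] seq_label[of "\<tau> i"] by simp
  next
    case False
    then show ?thesis
      using G by (auto simp: tree_seq_def compatible_seqs_def extensional_def)
  qed
  then have seq: "seq = G" by auto
  have "compatible M v T \<sigma> F"
    using G unfolding compatible_iff seq by (simp add: compatible_seqs_def)
  then have "(T, \<sigma>, F) \<in> compatible_trees M k v"
    using flat_filled_tree_axioms by (simp add: compatible_trees_iff \<sigma>_def F_def)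
  then show ?thesis
    using seq by blast
qed

lemma bij_betw_tree_seq: "bij_betw (tree_seq k) (compatible_trees M k v) (compatible_seqs M k v)"
proof -
  have "tree_seq k t \<in> compatible_seqs M k v" if "t \<in> compatible_trees M k v" for t
    using that by (cases t) (auto simp: compatible_trees_iff flat_filled_tree.seq_compatible)
  then show ?thesis
    using inj_on_tree_seq tree_seq_surj by (auto simp: bij_betw_def)
qed

section \<open>Polynomials\<close>

lemma carrier_polynomial_ring:
  "p \<in> carrier (polynomial_ring I) \<longleftrightarrow> (\<forall>m\<in>Poly_Mapping.keys p. Poly_Mapping.keys m \<subseteq> I)"
  by (simp add: polynomial_ring_def)

lemma polynomial_ring_simps [simp]:
  "x \<oplus>\<^bsub>polynomial_ring I\<^esub> y = x + y" "x \<otimes>\<^bsub>polynomial_ring I\<^esub> y = x * y"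
  "\<zero>\<^bsub>polynomial_ring I\<^esub> = 0" "\<one>\<^bsub>polynomial_ring I\<^esub> = 1"
  by (simp_all add: polynomial_ring_def)

lemma poly_zero_closed [simp]: "0 \<in> carrier (polynomial_ring I)"
  by (simp add: carrier_polynomial_ring)

lemma poly_one_closed [simp]: "1 \<in> carrier (polynomial_ring I)"
  by (simp add: carrier_polynomial_ring)

lemma poly_add_closed [simp]:
  "p \<in> carrier (polynomial_ring I) \<Longrightarrow> q \<in> carrier (polynomial_ring I) \<Longrightarrow>
    p + q \<in> carrier (polynomial_ring I)"
  using Poly_Mapping.keys_add[of p q] by (fastforce simp: carrier_polynomial_ring)

lemma poly_uminus_closed [simp]:
  "p \<in> carrier (polynomial_ring I) \<Longrightarrow> - p \<in> carrier (polynomial_ring I)"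
  by (simp add: carrier_polynomial_ring)

lemma poly_diff_closed [simp]:
  "p \<in> carrier (polynomial_ring I) \<Longrightarrow> q \<in> carrier (polynomial_ring I) \<Longrightarrow>
    p - q \<in> carrier (polynomial_ring I)"
  using poly_add_closed[of p I "- q"] by simp

lemma poly_mult_closed [simp]:
  assumes "p \<in> carrier (polynomial_ring I)" "q \<in> carrier (polynomial_ring I)"
  shows "p * q \<in> carrier (polynomial_ring I)"
  unfolding carrier_polynomial_ring
proof
  fix m assume "m \<in> Poly_Mapping.keys (p * q)"
  then obtain a b where "m = a + b" "a \<in> Poly_Mapping.keys p" "b \<in> Poly_Mapping.keys q"
    using keys_mult[of p q] by blast
  then show "Poly_Mapping.keys m \<subseteq> I"
    using assms Poly_Mapping.keys_add[of a b] unfolding carrier_polynomial_ring by blast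
qed

lemma poly_sum_closed [simp]:
  "(\<And>a. a \<in> A \<Longrightarrow> f a \<in> carrier (polynomial_ring I)) \<Longrightarrow> sum f A \<in> carrier (polynomial_ring I)"
  by (induction A rule: infinite_finite_induct) auto

lemma poly_prod_closed [simp]:
  "(\<And>a. a \<in> A \<Longrightarrow> f a \<in> carrier (polynomial_ring I)) \<Longrightarrow> prod f A \<in> carrier (polynomial_ring I)"
  by (induction A rule: infinite_finite_induct) auto

lemma Const_closed [simp]: "Const c \<in> carrier (polynomial_ring I)"
  by (simp add: carrier_polynomial_ring Const_def)

lemma Var_closed [simp]: "i \<in> I \<Longrightarrow> Var i \<in> carrier (polynomial_ring I)"
  by (simp add: carrier_polynomial_ring Var_def)

lemma Const_0 [simp]: "Const 0 = 0"
  by (simp add: Const_def)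

lemma Const_1 [simp]: "Const 1 = 1"
  by (simp add: Const_def)

lemma Const_add: "Const (a + b) = Const a + Const b"
  by (simp add: Const_def single_add)

lemma Const_mult: "Const (a * b) = Const a * Const b"
  by (simp add: Const_def mult_single)

lemma Const_sum: "Const (sum f A) = (\<Sum>a\<in>A. Const (f a))"
  by (induction A rule: infinite_finite_induct) (simp_all add: Const_add)

lemma cring_polynomial_ring: "cring (polynomial_ring I)"
proof (rule cringI)
  show "abelian_group (polynomial_ring I)"
  proof (rule abelian_groupI)
    fix p assume "p \<in> carrier (polynomial_ring I)"
    then show "\<exists>q\<in>carrier (polynomial_ring I). q \<oplus>\<^bsub>polynomial_ring I\<^esub> p = \<zero>\<^bsub>polynomial_ring I\<^esub>"
      by (intro bexI[of _ "- p"]) simp_all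
  qed (simp_all add: ac_simps)
  show "comm_monoid (polynomial_ring I)"
    by unfold_locales (simp_all add: ac_simps)
qed (simp add: distrib_right)

section \<open>Coefficients from weight vectors\<close>

text \<open>Counting the larger elements ranks \<open>D\<close> bijectively onto
  \<open>{..<card D}\<close>, and \<open>largest j D\<close> consists of the elements of rank below
  \<open>j\<close>.\<close>

lemma card_largest:
  fixes D :: "'a::linorder set"
  assumes "finite D" "j \<le> card D"
  shows "card (largest j D) = j"
proof -
  define r where "r x = card {y \<in> D. x < y}" for x
  have less: "r y < r x" if "x < y" "y \<in> D" for x y
    unfolding r_def using assms(1) that by (intro psubset_card_mono) auto
  have inj: "inj_on r D"
    using less by (intro linorder_inj_onI) (fastforce, auto)
  have "r ` D \<subseteq> {..<card D}"
    unfolding r_def using assms(1) by (auto intro!: psubset_card_mono)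
  then have "r ` D = {..<card D}"
    using card_image[OF inj] by (intro card_subset_eq) auto
  moreover have "largest j D = {x \<in> D. r x < j}"
    by (simp add: largest_def r_def)
  ultimately have "r ` largest j D = {..<j}"
    using assms(2) by (auto simp: image_iff set_eq_iff) (metis lessThan_iff imageE order_less_le_trans)+
  then show ?thesis
    using card_image[OF inj_on_subset[OF inj, of "largest j D"]] by (auto simp: largest_def)
qed

text \<open>This isolates what the two weights share: in a gap from \<open>A\<close> to
  \<open>B\<close> the coefficient comes from a weight vector of total mass \<open>m\<close> that is
  1 on \<open>A\<close> and 0 off \<open>B\<close>. The vector may depend on the gap and on
  \<open>m\<close>, but not on \<open>S\<close>.\<close>

definition gap_coefficient :: "'a set \<Rightarrow> ('a set \<Rightarrow> 'a set \<Rightarrow> 'a set \<Rightarrow> nat \<Rightarrow> real) \<Rightarrow> bool" where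
  "gap_coefficient E \<omega> \<longleftrightarrow>
     (\<forall>A B m. A \<subseteq> B \<longrightarrow> B \<subseteq> E \<longrightarrow> card A < m \<longrightarrow> m < card B \<longrightarrow>
        (\<exists>w. (\<forall>e\<in>A. w e = 1) \<and> (\<forall>e\<in>E - B. w e = 0) \<and> sum w (B - A) = real m - real (card A) \<and>
             (\<forall>S. A \<subset> S \<longrightarrow> S \<subset> B \<longrightarrow> \<omega> A B S m = min (real (card S)) (real m) - sum w S)))"

text \<open>The mass left after \<open>A\<close> is spread at rate \<open>?q\<close> over
  \<open>B - A\<close>. Removing \<open>card A\<close> from both the minimum and the sum gives the
  expression \<open>mlt\<close> for the gap.\<close>

lemma gap_coefficient_mlt:
  assumes "finite E"
  shows "gap_coefficient E (\<lambda>A B S m. mlt (B - A) (card (S - A)) (int m - int (card A)))"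
  unfolding gap_coefficient_def
proof (intro allI impI)
  fix A B and m :: nat
  assume AB: "A \<subseteq> B" "B \<subseteq> E" "card A < m" "m < card B"
  let ?q = "(real m - real (card A)) / real (card (B - A))"
  let ?w = "\<lambda>e. if e \<in> A then 1 else if e \<in> B then ?q else 0"
  have "finite B"
    using AB(2) assms by (rule finite_subset)
  with AB(1) have fin: "finite A" "finite B"
    by (auto intro: finite_subset)
  have cBA: "card (B - A) = card B - card A"
    using AB fin by (simp add: card_Diff_subset)
  have "sum ?w (B - A) = (\<Sum>e\<in>B - A. ?q)"
    by (intro sum.cong) auto
  also have "\<dots> = real m - real (card A)"
    using AB cBA by simp
  finally have tot: "sum ?w (B - A) = real m - real (card A)" .
  have "mlt (B - A) (card (S - A)) (int m - int (card A)) = min (real (card S)) (real m) - sum ?w S"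
    if S: "A \<subset> S" "S \<subset> B" for S
  proof -
    have fS: "finite S" using S fin(2) finite_subset[of S B] by auto
    have "card (S - A) = card S - card A" "card A \<le> card S"
      using S fin fS by (auto simp: card_Diff_subset card_mono)
    then have c: "real (card (S - A)) = real (card S) - real (card A)"
      by simp
    have "sum ?w S = sum ?w (S - A) + sum ?w A"
      using S fS by (intro sum.subset_diff) auto
    also have "sum ?w (S - A) = (\<Sum>e\<in>S - A. ?q)"
      using S by (intro sum.cong) auto
    also have "sum ?w A = (\<Sum>e\<in>A. 1)"
      by (intro sum.cong) auto
    finally have "sum ?w S = real (card (S - A)) * ?q + real (card A)"
      by simp
    then show ?thesis
      using c by (auto simp: mlt_def min_def)
  qed
  then show "\<exists>w. (\<forall>e\<in>A. w e = 1) \<and> (\<forall>e\<in>E - B. w e = 0) \<and> sum w (B - A) = real m - real (card A) \<and>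
      (\<forall>S. A \<subset> S \<longrightarrow> S \<subset> B \<longrightarrow> mlt (B - A) (card (S - A)) (int m - int (card A)) =
         min (real (card S)) (real m) - sum w S)"
    using tot AB by (intro exI[of _ ?w]) auto
qed

text \<open>Here \<open>w\<close> is the indicator of \<open>A\<close> together with
  \<open>B - U\<close>, a set of \<open>m\<close> elements. As integers,
  \<open>card (S - A) + card U - card (B - A)\<close> equals \<open>card S - m\<close>, so the
  maximum in \<open>OI\<close> is \<open>card S\<close> minus the minimum of \<open>card S\<close>
  and \<open>m\<close>.\<close>

lemma gap_coefficient_OI:
  fixes E :: "'a::linorder set"
  assumes "finite E"
  shows "gap_coefficient E (\<lambda>A B S m. real_of_int (OI (B - A) (S - A) (largest (card B - m) (B - A))))"
  unfolding gap_coefficient_def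
proof (intro allI impI)
  fix A B :: "'a set" and m :: nat
  assume AB: "A \<subseteq> B" "B \<subseteq> E" "card A < m" "m < card B"
  define U where "U = largest (card B - m) (B - A)"
  define w :: "'a \<Rightarrow> real" where "w e = (if e \<in> A \<or> e \<in> B - U then 1 else 0)" for e
  have "finite B"
    using AB(2) assms by (rule finite_subset)
  with AB(1) have fin: "finite A" "finite B"
    by (auto intro: finite_subset)
  have cBA: "card (B - A) = card B - card A"
    using AB fin by (simp add: card_Diff_subset)
  have cU: "card U = card B - m"
    unfolding U_def using fin cBA AB by (intro card_largest) auto
  have U: "U \<subseteq> B - A"
    by (auto simp: U_def largest_def)
  have sum_w: "sum w (S - A) = real (card (S - A)) - real (card ((S - A) \<inter> U))"
    if S: "S \<subseteq> B" for S
  proof -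
    have fS: "finite S" using S fin(2) finite_subset[of S B] by auto
    have "sum w (S - A) = (\<Sum>e\<in>S - A. if e \<in> - U then 1 else 0)"
      using S U by (intro sum.cong) (auto simp: w_def)
    also have "\<dots> = real (card ((S - A) \<inter> - U))"
      using fS sum.inter_restrict[of "S - A" "\<lambda>_. 1 :: real" "- U"] by simp
    also have "(S - A) \<inter> - U = (S - A) - (S - A) \<inter> U" by blast
    also have "real (card \<dots>) = real (card (S - A)) - real (card ((S - A) \<inter> U))"
      using fS by (simp add: card_Diff_subset card_mono of_nat_diff)
    finally show ?thesis .
  qed
  have "(B - A) \<inter> U = U" using U by blast
  then have tot: "sum w (B - A) = real m - real (card A)"
    using sum_w[of B] cU cBA AB by simp
  have "real_of_int (OI (B - A) (S - A) U) = min (real (card S)) (real m) - sum w S"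
    if S: "A \<subset> S" "S \<subset> B" for S
  proof -
    have fS: "finite S" using S fin(2) finite_subset[of S B] by auto
    have "card (S - A) = card S - card A" "card A \<le> card S"
      using S fin fS by (auto simp: card_Diff_subset card_mono)
    then have c: "int (card (S - A)) = int (card S) - int (card A)"
      by simp
    have "sum w S = sum w (S - A) + sum w A"
      using S fS by (intro sum.subset_diff) auto
    also have "sum w A = (\<Sum>e\<in>A. 1)"
      by (intro sum.cong) (auto simp: w_def)
    finally have "sum w S = real (card (S - A)) - real (card ((S - A) \<inter> U)) + real (card A)"
      using sum_w[of S] S by simp
    moreover have "int (card (S - A)) + int (card U) - int (card (B - A)) = int (card S) - int m"
      using c cU cBA AB by simp
    ultimately show ?thesis
      using c by (auto simp: OI_def min_def max_def)
  qed
  then show "\<exists>w. (\<forall>e\<in>A. w e = 1) \<and> (\<forall>e\<in>E - B. w e = 0) \<and> sum w (B - A) = real m - real (card A) \<and>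
      (\<forall>S. A \<subset> S \<longrightarrow> S \<subset> B \<longrightarrow> real_of_int (OI (B - A) (S - A) (largest (card B - m) (B - A))) =
         min (real (card S)) (real m) - sum w S)"
    using tot AB by (intro exI[of _ w]) (auto simp: U_def[symmetric] w_def)
qed

section \<open>The Chow ring\<close>

definition chain_monomial :: "'a set set \<Rightarrow> 'a set mpoly" where
  "chain_monomial C = (\<Prod>G\<in>C. Var G)"

text \<open>A polynomial representative of \<open>hypersimplex_class M m\<close>; subsets that are
  not proper flats are left out because their \<open>chow_x\<close> is zero.\<close>

definition gamma_poly :: "'a set_system \<Rightarrow> nat \<Rightarrow> 'a set mpoly" where
  "gamma_poly M m =
     (if 1 \<le> m \<and> m < card (ground M)
      then \<Sum>S\<in>proper_flats M. Const (mlt (ground M) (card S) (int m)) * Var S else 0)"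

text \<open>These are the flats by which a compatible sequence with image \<open>C\<close> can be
  continued when the next entry of \<open>v\<close> is \<open>m\<close>.\<close>

definition compatible_extensions :: "'a set_system \<Rightarrow> 'a set set \<Rightarrow> nat \<Rightarrow> 'a set set" where
  "compatible_extensions M C m =
     {S \<in> proper_flats M. (\<forall>H\<in>C. H \<subset> S \<or> S \<subset> H) \<and>
        card (lower_flat C S) < m \<and> m < card (upper_flat (ground M) C S)}"

locale chow =
  fixes M :: "'a set_system"
  assumes finite_ground: "finite (ground M)"
begin

abbreviation "E \<equiv> ground M"
abbreviation "P \<equiv> proper_flats M"
abbreviation "R \<equiv> polynomial_ring P"
abbreviation "A \<equiv> chow_ring M"
abbreviation "cl \<equiv> chow_class M"

lemma P_subset: "S \<in> P \<Longrightarrow> S \<subseteq> E"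
  by (simp add: proper_flats_def flat_def)

lemma P_proper: "S \<in> P \<Longrightarrow> S \<noteq> {} \<and> S \<subset> E"
  by (auto simp: proper_flats_def flat_def)

lemma finite_P: "finite P"
  using finite_subset[of P "Pow E"] P_subset finite_ground by auto

lemma finite_flat: "S \<in> P \<Longrightarrow> finite S"
  using P_subset finite_ground finite_subset by metis

lemma relations_closed: "chow_relations M \<subseteq> carrier R"
  by (auto simp: chow_relations_def intro!: poly_mult_closed poly_diff_closed poly_sum_closed Var_closed)

lemma ideal_chow: "ideal (chow_ideal M) R"
  unfolding chow_ideal_def
  by (rule ring.genideal_ideal[OF cring.axioms(1)[OF cring_polynomial_ring] relations_closed])

lemma cring_chow: "cring A"
  unfolding chow_ring_def
  by (rule ideal.quotient_is_cring[OF ideal_chow cring_polynomial_ring])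

sublocale cring A
  by (rule cring_chow)

lemma cl_hom: "ring_hom_cring R A cl"
proof -
  have "cl = (+>\<^bsub>R\<^esub>) (chow_ideal M)"
    by (simp add: chow_class_def fun_eq_iff)
  then show ?thesis
    unfolding chow_ring_def
    using ideal.rcos_ring_hom_cring[OF ideal_chow cring_polynomial_ring] by simp
qed

lemma cl_ring_hom: "cl \<in> ring_hom R A"
  using cl_hom by (simp add: ring_hom_cring_def ring_hom_cring_axioms_def)

lemma cl_closed [simp]: "p \<in> carrier R \<Longrightarrow> cl p \<in> carrier A"
  by (rule ring_hom_closed[OF cl_ring_hom])

lemma cl_add: "p \<in> carrier R \<Longrightarrow> q \<in> carrier R \<Longrightarrow> cl (p + q) = cl p \<oplus>\<^bsub>A\<^esub> cl q"
  using ring_hom_add[OF cl_ring_hom, of p q] by simp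

lemma cl_mult: "p \<in> carrier R \<Longrightarrow> q \<in> carrier R \<Longrightarrow> cl (p * q) = cl p \<otimes>\<^bsub>A\<^esub> cl q"
  using ring_hom_mult[OF cl_ring_hom, of p q] by simp

lemma cl_0: "cl 0 = \<zero>\<^bsub>A\<^esub>"
  using ring_hom_cring.hom_zero[OF cl_hom] by simp

lemma cl_1: "cl 1 = \<one>\<^bsub>A\<^esub>"
  using ring_hom_one[OF cl_ring_hom] by simp

lemma cl_sum: "(\<And>a. a \<in> I \<Longrightarrow> f a \<in> carrier R) \<Longrightarrow> cl (sum f I) = (\<Oplus>\<^bsub>A\<^esub>a\<in>I. cl (f a))"
  by (induction I rule: infinite_finite_induct) (simp_all add: cl_0 cl_add Pi_def)

lemma cl_prod: "(\<And>a. a \<in> I \<Longrightarrow> f a \<in> carrier R) \<Longrightarrow> cl (prod f I) = (\<Otimes>\<^bsub>A\<^esub>a\<in>I. cl (f a))"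
  by (induction I rule: infinite_finite_induct) (simp_all add: cl_1 cl_mult Pi_def)

text \<open>Congruences modulo the ideal pass through sums, so calculations can stay in the
  polynomial type and meet the quotient only through \<open>cl\<close>.\<close>

lemma cl_sum_cong:
  assumes "\<And>a. a \<in> I \<Longrightarrow> f a \<in> carrier R" "\<And>a. a \<in> I \<Longrightarrow> g a \<in> carrier R"
    "\<And>a. a \<in> I \<Longrightarrow> cl (f a) = cl (g a)"
  shows "cl (sum f I) = cl (sum g I)"
  using assms by (simp add: cl_sum) (intro finsum_cong', auto)

lemma cl_mult_cong:
  assumes "p \<in> carrier R" "q \<in> carrier R" "cl p = cl q" "r \<in> carrier R"
  shows "cl (r * p) = cl (r * q)"
  using assms by (simp add: cl_mult)

lemma cl_ideal: "p \<in> chow_ideal M \<Longrightarrow> cl p = \<zero>\<^bsub>A\<^esub>"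
proof -
  assume p: "p \<in> chow_ideal M"
  interpret ideal "chow_ideal M" R by (rule ideal_chow)
  show ?thesis
    using a_rcos_const[OF p] by (simp add: chow_class_def chow_ring_def FactRing_def)
qed

lemma relations_in_ideal: "chow_relations M \<subseteq> chow_ideal M"
  unfolding chow_ideal_def
  by (rule ring.genideal_self[OF cring.axioms(1)[OF cring_polynomial_ring] relations_closed])

lemma cl_incomparable:
  assumes "S \<in> P" "H \<in> P" "\<not> S \<subseteq> H" "\<not> H \<subseteq> S"
  shows "cl (Var S * Var H) = \<zero>\<^bsub>A\<^esub>"
proof -
  have "Var S * Var H \<in> chow_relations M"
    using assms by (auto simp: chow_relations_def)
  then show ?thesis
    using relations_in_ideal cl_ideal by blast
qed

section \<open>Linear relations and change of the weight vector\<close>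

definition alpha :: "'a \<Rightarrow> 'a set mpoly" where
  "alpha i = (\<Sum>G\<in>{G \<in> P. i \<in> G}. Var G)"

lemma alpha_closed [simp]: "alpha i \<in> carrier R"
  by (auto simp: alpha_def intro!: poly_sum_closed)

lemma cl_alpha:
  assumes "i \<in> E" "j \<in> E"
  shows "cl (alpha i) = cl (alpha j)"
proof -
  have "alpha i - alpha j \<in> chow_relations M"
    using assms by (auto simp: chow_relations_def alpha_def)
  then have "cl (alpha i - alpha j) = \<zero>\<^bsub>A\<^esub>"
    using relations_in_ideal cl_ideal by blast
  then show ?thesis
    using cl_add[of "alpha i - alpha j" "alpha j"] by simp
qed

text \<open>Every \<open>alpha e\<close> has the class of one fixed \<open>alpha j\<close>, which
  leaves the class of \<open>alpha j\<close> scaled by \<open>sum c E\<close>. For an empty ground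
  set the sum is empty.\<close>

lemma cl_alpha_combination:
  fixes c :: "'a \<Rightarrow> real"
  assumes "sum c E = 0"
  shows "cl (\<Sum>e\<in>E. Const (c e) * alpha e) = \<zero>\<^bsub>A\<^esub>"
proof (cases "E = {}")
  case False
  then obtain j where j: "j \<in> E" by blast
  have "cl (\<Sum>e\<in>E. Const (c e) * alpha e) = cl (\<Sum>e\<in>E. Const (c e) * alpha j)"
    by (intro cl_sum_cong cl_mult_cong cl_alpha j) simp_all
  also have "(\<Sum>e\<in>E. Const (c e) * alpha j) = Const (sum c E) * alpha j"
    by (simp add: Const_sum sum_distrib_right)
  finally show ?thesis
    using assms by (simp add: cl_0)
qed (simp add: cl_0)

lemma gamma_poly_closed [simp]: "gamma_poly M m \<in> carrier R"
  by (simp add: gamma_poly_def)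

lemma chain_monomial_closed [simp]: "C \<subseteq> P \<Longrightarrow> chain_monomial C \<in> carrier R"
  by (auto simp: chain_monomial_def intro!: poly_prod_closed)

text \<open>Only the total mass of the weight vector \<open>w\<close> matters, because the classes of all
  \<open>alpha e\<close> coincide.\<close>

lemma cl_gamma_weight:
  fixes w :: "'a \<Rightarrow> real"
  assumes m: "1 \<le> m" "m < card E" and w: "sum w E = real m"
  shows "cl (gamma_poly M m) =
    cl (\<Sum>S\<in>P. Const (min (real (card S)) (real m) - sum w S) * Var S)"
proof -
  \<comment> \<open>\<open>c\<close> is the deviation of \<open>w\<close> from the uniform vector of
    mass \<open>m\<close>, the vector behind the coefficients \<open>mlt E\<close>.\<close>
  define c where "c e = w e - real m / real (card E)" for e
  have "sum c E = 0"
    using m w by (simp add: c_def sum_subtractf)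
  have "(\<Sum>e\<in>E. Const (c e) * alpha e) = (\<Sum>e\<in>E. \<Sum>G\<in>{G. G \<in> P \<and> e \<in> G}. Const (c e) * Var G)"
    by (simp add: alpha_def sum_distrib_left)
  \<comment> \<open>Interchanging the sums lets \<open>Var G\<close> collect the total deviation on
    \<open>G\<close>.\<close>
  also have "\<dots> = (\<Sum>G\<in>P. \<Sum>e\<in>{e. e \<in> E \<and> e \<in> G}. Const (c e) * Var G)"
    using finite_ground finite_P by (rule sum.swap_restrict)
  also have "\<dots> = (\<Sum>G\<in>P. Const (sum c G) * Var G)"
  proof (rule sum.cong)
    fix G assume "G \<in> P"
    then have "{e. e \<in> E \<and> e \<in> G} = G" using P_subset by blast
    then show "(\<Sum>e\<in>{e. e \<in> E \<and> e \<in> G}. Const (c e) * Var G) = Const (sum c G) * Var G"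
      by (simp add: Const_sum sum_distrib_right)
  qed simp
  finally have comb: "(\<Sum>e\<in>E. Const (c e) * alpha e) = (\<Sum>G\<in>P. Const (sum c G) * Var G)" .
  have coef: "mlt E (card S) (int m) = (min (real (card S)) (real m) - sum w S) + sum c S" for S
    by (auto simp: mlt_def c_def sum_subtractf min_def)
  have "gamma_poly M m =
      (\<Sum>S\<in>P. Const (min (real (card S)) (real m) - sum w S) * Var S) + (\<Sum>e\<in>E. Const (c e) * alpha e)"
    unfolding comb using m by (simp add: gamma_poly_def coef Const_add distrib_right sum.distrib)
  then show ?thesis
    using cl_alpha_combination[OF \<open>sum c E = 0\<close>] by (simp add: cl_add)
qed

text \<open>Flats outside \<open>Q\<close> contribute nothing: either an incomparable member of the
  chain annihilates the class of \<open>Var S\<close>, or the coefficient is zero. Leaving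
  \<open>Q\<close> and \<open>w\<close> free serves both the vanishing case and a genuine
  gap.\<close>

lemma cl_gamma_chain:
  fixes w :: "'a \<Rightarrow> real"
  assumes C: "C \<subseteq> P" and m: "1 \<le> m" "m < card E" and w: "sum w E = real m"
    and Q: "Q \<subseteq> P" "\<And>S. S \<in> P - Q \<Longrightarrow>
      (\<exists>H\<in>C. \<not> S \<subseteq> H \<and> \<not> H \<subseteq> S) \<or> min (real (card S)) (real m) = sum w S"
  shows "cl (chain_monomial C * gamma_poly M m) =
    cl (\<Sum>S\<in>Q. Const (min (real (card S)) (real m) - sum w S) * (Var S * chain_monomial C))"
proof -
  let ?f = "\<lambda>S. Const (min (real (card S)) (real m) - sum w S) * (Var S * chain_monomial C)"
  have zero: "cl (?f S) = \<zero>\<^bsub>A\<^esub>" if S: "S \<in> P - Q" for S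
  proof (cases "\<exists>H\<in>C. \<not> S \<subseteq> H \<and> \<not> H \<subseteq> S")
    case True
    then obtain H where H: "H \<in> C" "\<not> S \<subseteq> H" "\<not> H \<subseteq> S" by blast
    have HP: "H \<in> P" "S \<in> P" "C - {H} \<subseteq> P" using H C S by auto
    have "chain_monomial C = Var H * chain_monomial (C - {H})"
      unfolding chain_monomial_def
      using H C finite_P finite_subset by (metis prod.remove)
    then have "cl (Var S * chain_monomial C) = cl ((Var S * Var H) * chain_monomial (C - {H}))"
      by (simp add: mult.assoc)
    also have "\<dots> = cl (Var S * Var H) \<otimes>\<^bsub>A\<^esub> cl (chain_monomial (C - {H}))"
      using HP by (intro cl_mult) simp_all
    also have "\<dots> = \<zero>\<^bsub>A\<^esub>"
      using HP H by (simp add: cl_incomparable)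
    finally show ?thesis
      using HP C by (subst cl_mult) simp_all
  next
    case False
    then have "min (real (card S)) (real m) = sum w S"
      using Q(2)[OF S] by blast
    then have "min (real (card S)) (real m) - sum w S = 0"
      by simp
    then show ?thesis
      by (simp only: Const_0 mult_zero_left cl_0)
  qed
  have closed: "?f S \<in> carrier R" if "S \<in> P" for S
    using that C by simp
  have "cl (chain_monomial C * gamma_poly M m) =
      cl (chain_monomial C * (\<Sum>S\<in>P. Const (min (real (card S)) (real m) - sum w S) * Var S))"
    using C by (intro cl_mult_cong cl_gamma_weight m w) simp_all
  also have "chain_monomial C * (\<Sum>S\<in>P. Const (min (real (card S)) (real m) - sum w S) * Var S) = sum ?f P"
    by (simp add: sum_distrib_left ac_simps)
  also have "sum ?f P = sum ?f (P - Q) + sum ?f Q"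
    using Q(1) finite_P by (rule sum.subset_diff)
  also have "cl \<dots> = cl (sum ?f (P - Q)) \<oplus>\<^bsub>A\<^esub> cl (sum ?f Q)"
    using closed Q(1) by (intro cl_add poly_sum_closed) blast+
  also have "cl (sum ?f (P - Q)) = cl (\<Sum>S\<in>P - Q. 0)"
    using closed zero by (intro cl_sum_cong) (simp_all add: cl_0)
  also have "\<dots> = \<zero>\<^bsub>A\<^esub>" by (simp add: cl_0)
  finally show ?thesis
    using closed Q(1) by (subst (asm) l_zero) (auto intro!: cl_closed poly_sum_closed)
qed

text \<open>The cases are: \<open>m\<close> at least the size of the ground set, a chain member with
  exactly \<open>m\<close> elements, and a genuine gap around \<open>m\<close>. In the first two
  there is no compatible extension, and the left side vanishes as well.\<close>

lemma cl_gamma_extension: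
  assumes \<omega>: "gap_coefficient E \<omega>" and C: "C \<subseteq> P"
    and chain: "\<And>H H'. H \<in> C \<Longrightarrow> H' \<in> C \<Longrightarrow> H \<subseteq> H' \<or> H' \<subseteq> H" and m: "1 \<le> m"
  shows "cl (chain_monomial C * gamma_poly M m) =
    cl (\<Sum>S\<in>compatible_extensions M C m.
          Const (\<omega> (lower_flat C S) (upper_flat E C S) S m) * (Var S * chain_monomial C))"
proof -
  let ?Q = "compatible_extensions M C m"
  have QP: "?Q \<subseteq> P"
    by (auto simp: compatible_extensions_def)
  have finC: "finite C"
    using C finite_P by (rule finite_subset)
  have finE: "finite S" if "S \<subseteq> E" for S
    using that finite_ground by (rule finite_subset)
  have low_sub: "lower_flat C S \<subseteq> E" for S
    using C P_subset by (fastforce simp: lower_flat_def)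
  have up_sub: "upper_flat E C S \<subseteq> E" for S
    by (auto simp: upper_flat_def)
  \<comment> \<open>The size bounds on the neighbours of a compatible extension pass to the whole
    chain: members below it have fewer than \<open>m\<close> elements, members above it
    more.\<close>
  have below: "card H < m" if "S \<in> ?Q" "H \<in> C" "H \<subset> S" for S H
  proof -
    have "H \<subseteq> lower_flat C S" using that by (auto simp: lower_flat_def)
    then have "card H \<le> card (lower_flat C S)" by (rule card_mono[OF finE[OF low_sub]])
    then show ?thesis using that by (simp add: compatible_extensions_def)
  qed
  have above: "m < card H" if "S \<in> ?Q" "H \<in> C" "S \<subset> H" for S H
  proof -
    have "upper_flat E C S \<subseteq> H" using that by (auto simp: upper_flat_def)
    moreover have "finite H" using that C finite_flat by blast
    ultimately have "card (upper_flat E C S) \<le> card H" by (simp add: card_mono)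
    then show ?thesis using that by (simp add: compatible_extensions_def)
  qed
  consider "card E \<le> m" | H where "m < card E" "H \<in> C" "card H = m"
    | "m < card E" "\<And>H. H \<in> C \<Longrightarrow> card H \<noteq> m"
    by (metis not_less)
  then show ?thesis
  proof cases
    case 1
    have "?Q = {}"
    proof (rule equals0I)
      fix S assume "S \<in> ?Q"
      then have "m < card (upper_flat E C S)" by (simp add: compatible_extensions_def)
      also have "\<dots> \<le> card E" by (rule card_mono[OF finite_ground up_sub])
      finally show False using 1 by simp
    qed
    then show ?thesis
      using 1 by (simp add: gamma_poly_def)
  next
    case (2 H)
    have "?Q = {}"
    proof (rule equals0I)
      fix S assume S: "S \<in> ?Q"
      then have "H \<subset> S \<or> S \<subset> H" using 2 by (simp add: compatible_extensions_def)
      then show False using below[OF S] above[OF S] 2 by fastforce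
    qed
    have H: "H \<subseteq> E" "finite H" using 2 C P_subset finite_flat by blast+
    \<comment> \<open>The indicator of \<open>H\<close> has mass \<open>m\<close>. If
      \<open>S\<close> is comparable to \<open>H\<close>, then \<open>card (S \<inter> H)\<close> is
      the minimum of \<open>card S\<close> and \<open>m\<close>, so its coefficient
      vanishes.\<close>
    let ?w = "\<lambda>e. if e \<in> H then 1 else 0 :: real"
    have sum_w: "sum ?w S = real (card (S \<inter> H))" if "S \<subseteq> E" for S
      using finE[OF that] sum.inter_restrict[of S "\<lambda>_. 1 :: real" H] by simp
    have "cl (chain_monomial C * gamma_poly M m) =
      cl (\<Sum>S\<in>{}. Const (min (real (card S)) (real m) - sum ?w S) * (Var S * chain_monomial C))"
    proof (rule cl_gamma_chain[OF C m 2(1)])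
      show "sum ?w E = real m"
        using sum_w[of E] H 2 by (simp add: inf_absorb2)
      fix S assume S: "S \<in> P - {}"
      then have SE: "S \<subseteq> E" using P_subset by blast
      have "min (real (card S)) (real m) = sum ?w S" if "S \<subseteq> H \<or> H \<subseteq> S"
        using that
      proof
        assume "S \<subseteq> H"
        then show ?thesis
          using card_mono[OF H(2), of S] 2 sum_w[OF SE] by (simp add: inf_absorb1)
      next
        assume "H \<subseteq> S"
        then show ?thesis
          using card_mono[OF finE[OF SE], of H] 2 sum_w[OF SE] by (simp add: inf_absorb2)
      qed
      then show "(\<exists>H\<in>C. \<not> S \<subseteq> H \<and> \<not> H \<subseteq> S) \<or> min (real (card S)) (real m) = sum ?w S"
        using 2 by blast
    qed simp
    then show ?thesis
      using \<open>?Q = {}\<close> by simp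
  next
    case 3
    \<comment> \<open>\<open>D\<close> and \<open>U\<close> are the ends of the gap around size
      \<open>m\<close>, with \<open>{}\<close> and \<open>E\<close> as defaults. Otherwise
      finiteness of the chain makes them members of it.\<close>
    define D where "D = \<Union>{H \<in> C. card H < m}"
    define U where "U = E \<inter> \<Inter>{H \<in> C. m < card H}"
    have fl: "finite H" "H \<subseteq> E" if "H \<in> C" for H
      using that C P_subset finite_flat by blast+
    have mono: "H \<subset> H'" if "H \<in> C" "H' \<in> C" "card H < card H'" for H H'
      using chain[OF that(1,2)] that fl card_mono by (metis leD psubsetI order_less_irrefl)
    have subchain: "subset.chain UNIV {H \<in> C. Pr H}" for Pr
      using chain by (auto simp: subset_chain_def)
    have D_cases: "D = {} \<or> D \<in> C \<and> card D < m"
    proof (cases "{H \<in> C. card H < m} = {}")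
      case False
      then have "D \<in> {H \<in> C. card H < m}"
        unfolding D_def using finC by (intro Union_in_chain[OF _ _ subchain]) auto
      then show ?thesis by simp
    qed (simp add: D_def del: Union_empty_conv Collect_empty_eq)
    have U_cases: "U = E \<or> U \<in> C \<and> m < card U"
    proof (cases "{H \<in> C. m < card H} = {}")
      case False
      then have "\<Inter>{H \<in> C. m < card H} \<in> {H \<in> C. m < card H}"
        using finC by (intro Inter_in_chain[OF _ _ subchain]) auto
      moreover from this have "U = \<Inter>{H \<in> C. m < card H}"
        using fl(2) by (auto simp: U_def)
      ultimately show ?thesis by simp
    qed (simp add: U_def del: Collect_empty_eq)
    have DU: "D \<subseteq> U"
      unfolding D_def U_def
    proof (intro Union_least Int_greatest Inter_greatest)
      fix H assume H: "H \<in> {H \<in> C. card H < m}"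
      then show "H \<subseteq> E" using fl by blast
      fix H' assume "H' \<in> {H \<in> C. m < card H}"
      then show "H \<subseteq> H'" using mono[of H H'] H by auto
    qed
    have UE: "U \<subseteq> E" by (auto simp: U_def)
    \<comment> \<open>For the default values these bounds are \<open>1 \<le> m\<close> and
      \<open>m < card E\<close>.\<close>
    have cards: "card D < m" "m < card U"
      using D_cases U_cases m 3(1) by auto
    obtain w where w: "\<forall>e\<in>D. w e = 1" "\<forall>e\<in>E - U. w e = 0"
      "sum w (U - D) = real m - real (card D)"
      "\<forall>S. D \<subset> S \<longrightarrow> S \<subset> U \<longrightarrow> \<omega> D U S m = min (real (card S)) (real m) - sum w S"
      using \<omega>[unfolded gap_coefficient_def, rule_format, OF DU UE cards] by (elim exE conjE)
    have sum_D: "sum w S = real (card S)" if "S \<subseteq> D" for S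
    proof -
      have "sum w S = (\<Sum>e\<in>S. 1)"
        using w(1) that by (intro sum.cong) auto
      then show ?thesis by simp
    qed
    have sum_U: "sum w S = real m" if S: "U \<subseteq> S" "S \<subseteq> E" for S
    proof -
      have "sum w S = sum w (S - U) + (sum w (U - D) + sum w D)"
        using sum.subset_diff[OF S(1) finE[OF S(2)], of w] sum.subset_diff[OF DU finE[OF UE], of w]
        by simp
      moreover have "sum w (S - U) = 0"
        using w(2) S(2) by (intro sum.neutral) blast
      ultimately show ?thesis
        using w(3) sum_D[of D] by simp
    qed
    \<comment> \<open>All such \<open>S\<close> have the same neighbours \<open>D\<close> and
      \<open>U\<close>, so the single vector \<open>w\<close> serves every term.\<close>
    have flats: "lower_flat C S = D \<and> upper_flat E C S = U"
      if lo: "\<And>H. H \<in> C \<Longrightarrow> card H < m \<Longrightarrow> H \<subset> S"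
        and hi: "\<And>H. H \<in> C \<Longrightarrow> m < card H \<Longrightarrow> S \<subset> H" for S
    proof -
      have "(H \<subset> S \<longleftrightarrow> card H < m) \<and> (S \<subset> H \<longleftrightarrow> m < card H)" if "H \<in> C" for H
        using lo[OF that] hi[OF that] 3(2)[OF that] by (cases "card H" m rule: linorder_cases) auto
      then have "{H \<in> C. H \<subset> S} = {H \<in> C. card H < m}" "{H \<in> C. S \<subset> H} = {H \<in> C. m < card H}"
        by blast+
      then show ?thesis by (simp add: lower_flat_def upper_flat_def D_def U_def)
    qed
    have inQ: "lower_flat C S = D \<and> upper_flat E C S = U \<and> D \<subset> S \<and> S \<subset> U" if S: "S \<in> ?Q" for S
    proof -
      have cmp: "H \<subset> S \<or> S \<subset> H" if "H \<in> C" for H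
        using S that by (simp add: compatible_extensions_def)
      have SP: "S \<noteq> {}" "S \<subset> E"
        using S QP P_proper by blast+
      have lu: "lower_flat C S = D \<and> upper_flat E C S = U"
        using cmp below[OF S] above[OF S] by (intro flats) (fastforce dest: less_asym)+
      then have "D \<subseteq> S" "S \<subseteq> U"
        using SP by (auto simp: lower_flat_def upper_flat_def)
      moreover have "D \<noteq> S" "U \<noteq> S"
        using D_cases U_cases cmp SP by blast+
      ultimately show ?thesis using lu by blast
    qed
    have "cl (chain_monomial C * gamma_poly M m) =
      cl (\<Sum>S\<in>?Q. Const (min (real (card S)) (real m) - sum w S) * (Var S * chain_monomial C))"
    proof (rule cl_gamma_chain[OF C m 3(1) _ QP])
      show "sum w E = real m"
        using sum_U[OF UE] by simp
      fix S assume S: "S \<in> P - ?Q"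
      then have SE: "S \<subseteq> E" using P_subset by blast
      show "(\<exists>H\<in>C. \<not> S \<subseteq> H \<and> \<not> H \<subseteq> S) \<or> min (real (card S)) (real m) = sum w S"
      proof (cases "\<exists>H\<in>C. \<not> S \<subseteq> H \<and> \<not> H \<subseteq> S")
        \<comment> \<open>A flat comparable to the whole chain lies in \<open>D\<close>, contains
          \<open>U\<close>, or lies strictly between. The last would make it a compatible extension;
          in the other cases its mass under \<open>w\<close> is \<open>card S\<close> or
          \<open>m\<close>, which is then the minimum.\<close>
        case False
        then have cmp: "S \<subseteq> H \<or> H \<subseteq> S" if "H \<in> C" for H
          using that by blast
        have "S \<subseteq> D \<or> D \<subset> S"
          using cmp unfolding D_def by blast
        moreover have "U \<subseteq> S \<or> S \<subset> U"
          using cmp SE unfolding U_def by blast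
        moreover have False if "D \<subset> S" "S \<subset> U"
        proof -
          have "lower_flat C S = D \<and> upper_flat E C S = U"
            using that by (intro flats) (auto simp: D_def U_def)
          moreover have "H \<subset> S \<or> S \<subset> H" if "H \<in> C" for H
            using that \<open>D \<subset> S\<close> \<open>S \<subset> U\<close> 3(2)[OF that] unfolding D_def U_def
            by (cases "card H" m rule: linorder_cases) blast+
          ultimately have "S \<in> ?Q"
            using S cards by (simp add: compatible_extensions_def)
          then show False using S by simp
        qed
        moreover have "min (real (card S)) (real m) = sum w S" if "S \<subseteq> D"
          using sum_D[OF that] card_mono[OF finE[OF order_trans[OF DU UE]] that] cards by simp
        moreover have "min (real (card S)) (real m) = sum w S" if "U \<subseteq> S"
          using sum_U[OF that SE] card_mono[OF finE[OF SE] that] cards by simp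
        ultimately show ?thesis by blast
      qed simp
    qed
    also have "(\<Sum>S\<in>?Q. Const (min (real (card S)) (real m) - sum w S) * (Var S * chain_monomial C)) =
      (\<Sum>S\<in>?Q. Const (\<omega> (lower_flat C S) (upper_flat E C S) S m) * (Var S * chain_monomial C))"
      using inQ w(4) by (intro sum.cong) auto
    finally show ?thesis .
  qed
qed

section \<open>Iterated products and sequences of flats\<close>

definition seq_coefficient :: "('a set \<Rightarrow> 'a set \<Rightarrow> 'a set \<Rightarrow> nat \<Rightarrow> real) \<Rightarrow> nat \<Rightarrow> (nat \<Rightarrow> nat) \<Rightarrow>
    (nat \<Rightarrow> 'a set) \<Rightarrow> real" where
  "seq_coefficient \<omega> k v G =
     (\<Prod>i\<in>{1..k}. \<omega> (lower_flat (G ` {1..<i}) (G i)) (upper_flat E (G ` {1..<i}) (G i)) (G i) (v i))"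

lemma seq_image_subset: "G \<in> compatible_seqs M k v \<Longrightarrow> G ` {1..k} \<subseteq> P"
  by (auto simp: compatible_seqs_def)

lemma seq_image_chain:
  assumes G: "G \<in> compatible_seqs M k v" and H: "H \<in> G ` {1..k}" "H' \<in> G ` {1..k}"
  shows "H \<subseteq> H' \<or> H' \<subseteq> H"
proof -
  obtain i j where ij: "i \<in> {1..k}" "j \<in> {1..k}" "H = G i" "H' = G j"
    using H by blast
  have "G j \<subset> G i \<or> G i \<subset> G j" if "i \<in> {1..k}" "j \<in> {1..<i}" for i j
    using G that by (simp add: compatible_seqs_def)
  from this[of i j] this[of j i] show ?thesis
    using ij by (cases i j rule: linorder_cases) auto
qed

lemma fun_upd_image_Suc: "i \<le> Suc k \<Longrightarrow> (G(Suc k := S)) ` {1..<i} = G ` {1..<i}"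
  by auto

text \<open>The conditions at \<open>i\<close> look only at terms up to \<open>i\<close>, so a new
  value at \<open>Suc k\<close> leaves those up to \<open>k\<close> intact; the condition at
  \<open>Suc k\<close> is membership in \<open>compatible_extensions\<close>.\<close>

lemma compatible_seqs_Suc_iff:
  assumes "G \<in> extensional {1..k}"
  shows "G(Suc k := S) \<in> compatible_seqs M (Suc k) v \<longleftrightarrow>
    G \<in> compatible_seqs M k v \<and> S \<in> compatible_extensions M (G ` {1..k}) (v (Suc k))"
proof -
  let ?G = "G(Suc k := S)"
  define ok where "ok G i \<longleftrightarrow> G i \<in> P \<and> (\<forall>H\<in>G ` {1..<i}. H \<subset> G i \<or> G i \<subset> H) \<and>
    card (lower_flat (G ` {1..<i}) (G i)) < v i \<and> v i < card (upper_flat E (G ` {1..<i}) (G i))" for G i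
  have mem: "G \<in> compatible_seqs M k v \<longleftrightarrow> G \<in> extensional {1..k} \<and> (\<forall>i\<in>{1..k}. ok G i)" for G k
    by (auto simp: compatible_seqs_def ok_def)
  have "ok ?G i \<longleftrightarrow> ok G i" if "i \<in> {1..k}" for i
  proof -
    have "?G ` {1..<i} = G ` {1..<i}" "?G i = G i"
      using that by auto
    then show ?thesis by (simp only: ok_def)
  qed
  moreover have "ok ?G (Suc k) \<longleftrightarrow> S \<in> compatible_extensions M (G ` {1..k}) (v (Suc k))"
    unfolding ok_def fun_upd_image_Suc[OF order_refl] compatible_extensions_def
    by (simp add: atLeastLessThanSuc_atLeastAtMost)
  moreover have "?G \<in> extensional {1..Suc k}"
    using assms by (auto simp: extensional_def)
  moreover have "(\<forall>i\<in>{1..Suc k}. ok ?G i) \<longleftrightarrow> ok ?G (Suc k) \<and> (\<forall>i\<in>{1..k}. ok ?G i)"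
    by (simp add: atLeastAtMostSuc_conv)
  ultimately show ?thesis
    unfolding mem using assms by blast
qed

lemma compatible_seqs_Suc:
  "compatible_seqs M (Suc k) v =
     (\<lambda>(G, S). G(Suc k := S)) `
       (SIGMA G:compatible_seqs M k v. compatible_extensions M (G ` {1..k}) (v (Suc k)))"
proof (intro equalityI subsetI)
  fix G assume G: "G \<in> compatible_seqs M (Suc k) v"
  let ?H = "restrict G {1..k}"
  have eq: "?H(Suc k := G (Suc k)) = G"
    using G by (auto simp: compatible_seqs_def extensional_def fun_eq_iff)
  then have "?H \<in> compatible_seqs M k v \<and> G (Suc k) \<in> compatible_extensions M (?H ` {1..k}) (v (Suc k))"
    using G compatible_seqs_Suc_iff[of ?H k "G (Suc k)" v] by simp
  then show "G \<in> (\<lambda>(G, S). G(Suc k := S)) `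
       (SIGMA G:compatible_seqs M k v. compatible_extensions M (G ` {1..k}) (v (Suc k)))"
    using eq by (intro image_eqI[of _ _ "(?H, G (Suc k))"]) auto
next
  fix G assume "G \<in> (\<lambda>(G, S). G(Suc k := S)) `
       (SIGMA G:compatible_seqs M k v. compatible_extensions M (G ` {1..k}) (v (Suc k)))"
  then obtain H S where "G = H(Suc k := S)" "H \<in> compatible_seqs M k v"
    "S \<in> compatible_extensions M (H ` {1..k}) (v (Suc k))"
    by auto
  moreover from this have "H \<in> extensional {1..k}"
    by (simp add: compatible_seqs_def)
  ultimately show "G \<in> compatible_seqs M (Suc k) v"
    using compatible_seqs_Suc_iff by blast
qed

lemma inj_on_seq_extend:
  "inj_on (\<lambda>(G, S). G(Suc k := S))
     (SIGMA G:compatible_seqs M k v. compatible_extensions M (G ` {1..k}) (v (Suc k)))"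
proof (rule inj_onI, clarify)
  fix G S G' S'
  assume G: "G \<in> compatible_seqs M k v" "G' \<in> compatible_seqs M k v"
    and eq: "G(Suc k := S) = G'(Suc k := S')"
  have "S = S'"
    using fun_cong[OF eq, of "Suc k"] by simp
  moreover have "G i = G' i" for i
  proof (cases "i = Suc k")
    case True
    \<comment> \<open>The update hides this value, but extensionality makes it
      \<open>undefined\<close> in both sequences.\<close>
    then show ?thesis using G by (simp add: compatible_seqs_def extensional_def)
  next
    case False
    then show ?thesis using fun_cong[OF eq, of i] by simp
  qed
  ultimately show "G = G' \<and> S = S'" by auto
qed

lemma compatible_extensions_finite: "finite (compatible_extensions M C m)"
  using finite_P by (simp add: compatible_extensions_def)

lemma finite_compatible_seqs: "finite (compatible_seqs M k v)"
proof (induction k)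
  case 0
  then show ?case by (simp add: compatible_seqs_def)
next
  case (Suc k)
  then show ?case
    unfolding compatible_seqs_Suc by (intro finite_imageI finite_SigmaI compatible_extensions_finite)
qed

text \<open>In the induction step \<open>cl_gamma_extension\<close> expands the product of the new
  class with the monomial of each sequence; the pairs of a sequence and an extension are the
  sequences of length \<open>Suc k\<close>.\<close>

lemma cl_prod_gamma:
  assumes \<omega>: "gap_coefficient E \<omega>" and v: "\<And>i. i \<in> {1..k} \<Longrightarrow> 0 < v i"
  shows "cl (\<Prod>i\<in>{1..k}. gamma_poly M (v i)) =
    cl (\<Sum>G\<in>compatible_seqs M k v. Const (seq_coefficient \<omega> k v G) * chain_monomial (G ` {1..k}))"
  using v
proof (induction k)
  case 0
  \<comment> \<open>The everywhere undefined function is the only sequence of length 0; its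
    coefficient and monomial are empty products.\<close>
  have "compatible_seqs M 0 v = {\<lambda>_. undefined}"
    by (auto simp: compatible_seqs_def)
  then show ?case
    by (simp add: seq_coefficient_def chain_monomial_def)
next
  case (Suc k)
  let ?c = "seq_coefficient \<omega> k v" and ?X = "\<lambda>G. chain_monomial (G ` {1..k})"
  let ?Q = "\<lambda>G. compatible_extensions M (G ` {1..k}) (v (Suc k))"
  let ?d = "\<lambda>G S. \<omega> (lower_flat (G ` {1..k}) S) (upper_flat E (G ` {1..k}) S) S (v (Suc k))"
  let ?t = "\<lambda>G S. Const (?d G S) * (Var S * ?X G)"
  have QP: "S \<in> P" if "S \<in> ?Q G" for G S
    using that by (simp add: compatible_extensions_def)
  have X [simp]: "?X G \<in> carrier R" if "G \<in> compatible_seqs M k v" for G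
    using seq_image_subset[OF that] by simp
  have t [simp]: "sum (?t G) (?Q G) \<in> carrier R" if "G \<in> compatible_seqs M k v" for G
    using X[OF that] QP by (intro poly_sum_closed poly_mult_closed Const_closed Var_closed)
  have coef: "seq_coefficient \<omega> (Suc k) v (G(Suc k := S)) = ?c G * ?d G S" for G S
  proof -
    have "(\<Prod>i\<in>{1..k}. \<omega> (lower_flat ((G(Suc k := S)) ` {1..<i}) ((G(Suc k := S)) i))
        (upper_flat E ((G(Suc k := S)) ` {1..<i}) ((G(Suc k := S)) i)) ((G(Suc k := S)) i) (v i)) = ?c G"
      unfolding seq_coefficient_def
    proof (intro prod.cong refl)
      fix i assume "i \<in> {1..k}"
      then have "(G(Suc k := S)) ` {1..<i} = G ` {1..<i}" "(G(Suc k := S)) i = G i"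
        using fun_upd_image_Suc[of i k G S] by simp_all
      then show "\<omega> (lower_flat ((G(Suc k := S)) ` {1..<i}) ((G(Suc k := S)) i))
        (upper_flat E ((G(Suc k := S)) ` {1..<i}) ((G(Suc k := S)) i)) ((G(Suc k := S)) i) (v i) =
        \<omega> (lower_flat (G ` {1..<i}) (G i)) (upper_flat E (G ` {1..<i}) (G i)) (G i) (v i)"
        by (simp only:)
    qed
    moreover have "(G(Suc k := S)) ` {1..<Suc k} = G ` {1..k}"
      using fun_upd_image_Suc[of "Suc k" k G S] by (simp add: atLeastLessThanSuc_atLeastAtMost)
    ultimately show ?thesis
      unfolding seq_coefficient_def by (subst prod.nat_ivl_Suc') (simp_all add: mult.commute)
  qed
  \<comment> \<open>An extension is strictly comparable to every earlier term, hence new, so the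
    monomial gains the factor \<open>Var S\<close>.\<close>
  have mono: "chain_monomial ((G(Suc k := S)) ` {1..Suc k}) = Var S * ?X G" if S: "S \<in> ?Q G" for G S
  proof -
    have "S \<notin> G ` {1..k}"
      using S by (auto simp: compatible_extensions_def)
    moreover have "(G(Suc k := S)) ` {1..Suc k} = insert S (G ` {1..k})"
      by (auto simp: image_iff le_Suc_eq)
    ultimately show ?thesis
      by (simp add: chain_monomial_def)
  qed
  have "cl (\<Prod>i\<in>{1..Suc k}. gamma_poly M (v i)) =
      cl (gamma_poly M (v (Suc k)) * (\<Prod>i\<in>{1..k}. gamma_poly M (v i)))"
    by (subst prod.nat_ivl_Suc') simp_all
  also have "\<dots> = cl (gamma_poly M (v (Suc k)) * (\<Sum>G\<in>compatible_seqs M k v. Const (?c G) * ?X G))"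
    using Suc.prems
    by (intro cl_mult_cong Suc.IH poly_sum_closed poly_prod_closed poly_mult_closed Const_closed X
        gamma_poly_closed) auto
  also have "gamma_poly M (v (Suc k)) * (\<Sum>G\<in>compatible_seqs M k v. Const (?c G) * ?X G) =
      (\<Sum>G\<in>compatible_seqs M k v. Const (?c G) * (?X G * gamma_poly M (v (Suc k))))"
    by (simp add: sum_distrib_left ac_simps)
  also have "cl \<dots> = cl (\<Sum>G\<in>compatible_seqs M k v. Const (?c G) * sum (?t G) (?Q G))"
    using Suc.prems[of "Suc k"]
    by (intro cl_sum_cong cl_mult_cong cl_gamma_extension \<omega> seq_image_subset seq_image_chain
        poly_mult_closed gamma_poly_closed X t Const_closed) auto
  also have "(\<Sum>G\<in>compatible_seqs M k v. Const (?c G) * sum (?t G) (?Q G)) =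
      (\<Sum>G\<in>compatible_seqs M k v. \<Sum>S\<in>?Q G. Const (seq_coefficient \<omega> (Suc k) v (G(Suc k := S))) *
        chain_monomial ((G(Suc k := S)) ` {1..Suc k}))"
    unfolding sum_distrib_left
    by (intro sum.cong refl) (simp only: coef mono Const_mult mult.assoc)
  also have "\<dots> = (\<Sum>(G, S)\<in>(SIGMA G:compatible_seqs M k v. ?Q G).
      Const (seq_coefficient \<omega> (Suc k) v (G(Suc k := S))) *
        chain_monomial ((G(Suc k := S)) ` {1..Suc k}))"
    by (intro sum.Sigma finite_compatible_seqs ballI compatible_extensions_finite)
  also have "\<dots> = (\<Sum>G\<in>compatible_seqs M (Suc k) v.
      Const (seq_coefficient \<omega> (Suc k) v G) * chain_monomial (G ` {1..Suc k}))"
    unfolding compatible_seqs_Suc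
    by (subst sum.reindex[OF inj_on_seq_extend]) (simp add: case_prod_unfold)
  finally show ?case .
qed

section \<open>Passage from polynomials to the Chow ring\<close>

lemma chow_scale_cl: "p \<in> carrier R \<Longrightarrow> chow_scale M c (cl p) = cl (Const c * p)"
  by (simp add: chow_scale_def cl_mult)

text \<open>The defining sum runs over all nonempty proper subsets, but those outside
  \<open>P\<close> contribute zero.\<close>

lemma hypersimplex_class_cl: "hypersimplex_class M m = cl (gamma_poly M m)"
proof (cases "1 \<le> m \<and> m < card E")
  case True
  let ?g = "\<lambda>S. chow_scale M (mlt E (card S) (int m)) (chow_x M S)"
  let ?B = "{S. S \<noteq> {} \<and> S \<subset> E}"
  have sub: "P \<subseteq> ?B" using P_proper by blast
  have gP: "?g S = cl (Const (mlt E (card S) (int m)) * Var S)" if "S \<in> P" for S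
    using that by (simp add: chow_x_def chow_scale_cl)
  have g0: "?g S = \<zero>\<^bsub>A\<^esub>" if "S \<notin> P" for S
    using that by (simp add: chow_x_def chow_scale_def)
  have g_closed: "?g S \<in> carrier A" for S
    by (cases "S \<in> P") (simp_all add: gP g0)
  have fin: "finite ?B"
    using finite_ground by (rule finite_subset[of _ "Pow E", rotated, OF finite_Pow_iff[THEN iffD2]]) auto
  have "hypersimplex_class M m = finsum A ?g ?B"
    using True by (simp add: hypersimplex_class_def)
  also have "\<dots> = finsum A ?g P"
    using sub fin g0 g_closed by (intro add.finprod_mono_neutral_cong_right) auto
  also have "\<dots> = (\<Oplus>\<^bsub>A\<^esub>S\<in>P. cl (Const (mlt E (card S) (int m)) * Var S))"
    using gP by (intro finsum_cong') auto
  also have "\<dots> = cl (gamma_poly M m)"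
    using True by (simp add: gamma_poly_def cl_sum)
  finally show ?thesis .
qed (auto simp: hypersimplex_class_def gamma_poly_def cl_0)

lemma chow_x_chain_cl:
  assumes "F ` T \<subseteq> P"
  shows "chow_x_chain M T F = cl (chain_monomial (F ` T))"
proof -
  have "chow_x_chain M T F = (\<Otimes>\<^bsub>A\<^esub>G\<in>F ` T. cl (Var G))"
    unfolding chow_x_chain_def
    by (rule finprod_cong') (use assms in \<open>auto simp: chow_x_def\<close>)
  also have "\<dots> = cl (chain_monomial (F ` T))"
    unfolding chain_monomial_def using assms by (intro cl_prod[symmetric] Var_closed) blast
  finally show ?thesis .
qed

theorem prod_hypersimplex_class:
  assumes \<omega>: "gap_coefficient E \<omega>" and v: "\<And>i. i \<in> {1..k} \<Longrightarrow> 0 < v i"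
    and wt: "\<And>T \<sigma> F. wt T \<sigma> F =
      (\<Prod>b\<in>T. \<omega> (flat_left T \<sigma> F b) (flat_right M T \<sigma> F b) (F b) (v (\<sigma> b)))"
  shows "(\<Otimes>\<^bsub>A\<^esub>i\<in>{1..k}. hypersimplex_class M (v i)) =
    (\<Oplus>\<^bsub>A\<^esub>t\<in>compatible_trees M k v.
       case t of (T, \<sigma>, F) \<Rightarrow> chow_scale M (wt T \<sigma> F) (chow_x_chain M T F))"
proof -
  let ?f = "\<lambda>G. Const (seq_coefficient \<omega> k v G) * chain_monomial (G ` {1..k})"
  have closed: "?f G \<in> carrier R" if "G \<in> compatible_seqs M k v" for G
    using seq_image_subset[OF that] by simp
  have seqs: "tree_seq k t \<in> compatible_seqs M k v" if "t \<in> compatible_trees M k v" for t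
    using that bij_betw_apply[OF bij_betw_tree_seq] by blast
  have tree: "(case t of (T, \<sigma>, F) \<Rightarrow> chow_scale M (wt T \<sigma> F) (chow_x_chain M T F)) = cl (?f (tree_seq k t))"
    if t: "t \<in> compatible_trees M k v" for t
  proof -
    obtain T \<sigma> F where tt: "t = (T, \<sigma>, F)"
      by (metis prod.exhaust)
    interpret flat_filled_tree M k T \<sigma> F
      using t by (simp add: tt compatible_trees_iff)
    have FT: "F ` T \<subseteq> P"
      using filling by (simp add: flat_filling_def)
    have "wt T \<sigma> F = seq_coefficient \<omega> k v seq"
      unfolding wt prod_tree seq_coefficient_def ..
    then show ?thesis
      using FT by (simp add: tt chow_x_chain_cl chow_scale_cl seq_image_all[simplified])
  qed
  have "(\<Otimes>\<^bsub>A\<^esub>i\<in>{1..k}. hypersimplex_class M (v i)) = cl (\<Prod>i\<in>{1..k}. gamma_poly M (v i))"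
    by (simp add: hypersimplex_class_cl cl_prod)
  also have "\<dots> = cl (sum ?f (compatible_seqs M k v))"
    using \<omega> v by (rule cl_prod_gamma)
  also have "sum ?f (compatible_seqs M k v) = (\<Sum>t\<in>compatible_trees M k v. ?f (tree_seq k t))"
    by (rule sum.reindex_bij_betw[OF bij_betw_tree_seq, symmetric])
  also have "cl \<dots> = (\<Oplus>\<^bsub>A\<^esub>t\<in>compatible_trees M k v. cl (?f (tree_seq k t)))"
    using closed seqs by (intro cl_sum) blast
  also have "\<dots> = (\<Oplus>\<^bsub>A\<^esub>t\<in>compatible_trees M k v.
       case t of (T, \<sigma>, F) \<Rightarrow> chow_scale M (wt T \<sigma> F) (chow_x_chain M T F))"
    using tree closed seqs by (intro finsum_cong') (auto simp del: split_paired_All)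
  finally show ?thesis .
qed

end

theorem theorem5p2:
  fixes M :: "nat set_system" and n k :: nat and v :: "nat \<Rightarrow> nat"
    and wt :: "vertex set \<Rightarrow> (vertex \<Rightarrow> nat) \<Rightarrow> (vertex \<Rightarrow> nat set) \<Rightarrow> real"
  assumes "matroid M" and "ground M = {0..n}" and "loopless M"
    and "\<And>i. i \<in> {1..k} \<Longrightarrow> 0 < v i"
    and "wt = wt_OI M v \<or> wt = wt_mult M v"
  shows "(\<Otimes>\<^bsub>chow_ring M\<^esub>i\<in>{1..k}. hypersimplex_class M (v i)) =
           (\<Oplus>\<^bsub>chow_ring M\<^esub>t\<in>compatible_trees M k v.
              case t of (T, \<sigma>, F) \<Rightarrow> chow_scale M (wt T \<sigma> F) (chow_x_chain M T F))"
proof -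
  have fin: "finite (ground M)"
    using assms(2) by simp
  then interpret chow M
    by unfold_locales
  show ?thesis
    using assms(5)
  proof
    assume "wt = wt_OI M v"
    then show ?thesis
      using assms(4)
      by (intro prod_hypersimplex_class[OF gap_coefficient_OI[OF fin]]) (simp_all add: wt_OI_def Let_def)
  next
    assume "wt = wt_mult M v"
    then show ?thesis
      using assms(4)
      by (intro prod_hypersimplex_class[OF gap_coefficient_mlt[OF fin]]) (simp_all add: wt_mult_def Let_def)
  qed
qed

end
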